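(* Let $d\ge 2$ and $r\ge 1$ be integers. Let $m\ge 1$ be an integer such that there exist positive integers $n_1,\dots,n_d$ and a nonzero polynomial $f\in\mathbb{C}[x_{i_1,\dots,i_d}\mid i_j\in[n_j]]$ of degree $m$ that vanishes on all tensors in $\mathbb{C}^{n_1}\otimes\cdots\otimes\mathbb{C}^{n_d}$ of partition rank at most $r$. Then for every field $K$, all positive integers $n_1,\dots,n_d\ge m$ and every tensor $T\in K^{n_1}\otimes\cdots\otimes K^{n_d}$: if all subtensors $T[X_1,\dots,X_d]$ with $|X_1|=\cdots=|X_d|=m$ have partition rank at most $r$, then $$\mathrm{prk}(T)\le d(m-1)+\sum_{s=1}^{\lfloor d/2\rfloor}\binom{d}{s}(m-1)^{d-s}.$$ Moreover, for $d\ge 3$ this quantity is at most $m^d$. *)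

theory Defs
  imports Complex_Main "HOL-Library.Poly_Mapping"
begin

text \<open>Order-d tensors: functions on index lists of length d; the entries are only
  considered on the index box tdom d X = X 0 \<times> ... \<times> X (d-1).
  Coordinates are 0-based: [n] is represented by {..<n}.\<close>

definition tdom :: "nat \<Rightarrow> (nat \<Rightarrow> nat set) \<Rightarrow> nat list set" where
  "tdom d X = {is. length is = d \<and> (\<forall>j<d. is ! j \<in> X j)}"

definition prk_one_on :: "nat \<Rightarrow> (nat \<Rightarrow> nat set) \<Rightarrow> (nat list \<Rightarrow> 'a::field) \<Rightarrow> bool" where
  "prk_one_on d X t \<longleftrightarrow>
     (\<exists>A. A \<noteq> {} \<and> A \<subset> {..<d} \<and>
        (\<exists>g h. \<forall>is\<in>tdom d X. t is = g (nths is A) * h (nths is ({..<d} - A))))"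

definition prk_le_on :: "nat \<Rightarrow> (nat \<Rightarrow> nat set) \<Rightarrow> (nat list \<Rightarrow> 'a::field) \<Rightarrow> nat \<Rightarrow> bool" where
  "prk_le_on d X T r \<longleftrightarrow>
     (\<exists>ts :: nat \<Rightarrow> nat list \<Rightarrow> 'a. (\<forall>k<r. prk_one_on d X (ts k)) \<and>
        (\<forall>is\<in>tdom d X. T is = (\<Sum>k<r. ts k is)))"

text \<open>Partition rank of T restricted to the box X 0 \<times> ... \<times> X (d-1)
  (this is the subtensor T[X_1,...,X_d]).\<close>

definition prk_on :: "nat \<Rightarrow> (nat \<Rightarrow> nat set) \<Rightarrow> (nat list \<Rightarrow> 'a::field) \<Rightarrow> nat" where
  "prk_on d X T = (LEAST r. prk_le_on d X T r)"

type_synonym cpoly = "(nat list \<Rightarrow>\<^sub>0 nat) \<Rightarrow>\<^sub>0 complex"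

definition mono_deg :: "(nat list \<Rightarrow>\<^sub>0 nat) \<Rightarrow> nat" where
  "mono_deg mon = (\<Sum>v\<in>Poly_Mapping.keys mon. Poly_Mapping.lookup mon v)"

definition total_degree :: "cpoly \<Rightarrow> nat" where
  "total_degree f = Max (mono_deg ` Poly_Mapping.keys f)"

definition poly_vars :: "cpoly \<Rightarrow> nat list set" where
  "poly_vars f = (\<Union>mon\<in>Poly_Mapping.keys f. Poly_Mapping.keys mon)"

definition peval :: "cpoly \<Rightarrow> (nat list \<Rightarrow> complex) \<Rightarrow> complex" where
  "peval f x = (\<Sum>mon\<in>Poly_Mapping.keys f. Poly_Mapping.lookup f mon * (\<Prod>v\<in>Poly_Mapping.keys mon. x v ^ Poly_Mapping.lookup mon v))"

end

theory Submission
  imports Defs "HOL-Library.FuncSet" "HOL-Library.Multiset"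
begin

text \<open>Polarisation turns a polynomial of degree \<open>m\<close> vanishing on complex tensors of partition
  rank at most \<open>r\<close> into a nonzero form \<open>\<Sum> c\<^sub>M \<Prod>\<^bsub>e\<in>M\<^esub> x\<^sub>e\<close>, where \<open>M\<close> ranges over the perfect matchings
  of the box \<open>[m]\<^sup>d\<close>. The coefficient vectors of such vanishing forms are cut out by linear equations with
  integer coefficients, so there is a primitive integral one, and it stays nonzero over every field \<open>K\<close>.

  If the form vanishes on all \<open>m \<times> ... \<times> m\<close> subtensors of \<open>T\<close>, strip off the variables of a matching with
  nonzero coefficient one after the other, until the coefficient of the next variable \<open>x\<^sub>e\<close> does not
  vanish on \<open>T[Y\<^sub>1,...,Y\<^sub>d]\<close> for some \<open>Y\<^sub>j\<close> of size less than \<open>m\<close>. Outside the at most \<open>d(m - 1)\<close> slices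
  through the \<open>Y\<^sub>j\<close> this expresses the entry of \<open>T\<close> at \<open>i\<close> by products of entries in which the coordinates of
  \<open>i\<close> are split among at least two factors; one of these contains only \<open>s \<le> d/2\<close> of them. Grouping by
  this factor, which is determined by \<open>s\<close> positions and \<open>d - s\<close> elements of the \<open>Y\<^sub>j\<close>, gives the second
  summand.\<close>

section \<open>Partition rank\<close>

text \<open>A substitute for factoring through \<open>nths is A\<close>: factors of a split product
  can be written as functions of the whole index list, and \<open>depends_on_factor\<close> turns
  them back into functions of the sublist.\<close>

definition depends_on :: "nat \<Rightarrow> nat set \<Rightarrow> (nat list \<Rightarrow> 'b) \<Rightarrow> bool" where
  "depends_on d A G \<longleftrightarrow>
     (\<forall>is is'. length is = d \<longrightarrow> length is' = d \<longrightarrow> (\<forall>j<d. j \<in> A \<longrightarrow> is ! j = is' ! j) \<longrightarrow> G is = G is')"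

lemma depends_onI:
  assumes "\<And>is is'. length is = d \<Longrightarrow> length is' = d \<Longrightarrow> (\<And>j. j < d \<Longrightarrow> j \<in> A \<Longrightarrow> is ! j = is' ! j)
             \<Longrightarrow> G is = G is'"
  shows "depends_on d A G"
  using assms unfolding depends_on_def by blast

lemma depends_onD:
  assumes "depends_on d A G" "length is = d" "length is' = d"
    and "\<And>j. j < d \<Longrightarrow> j \<in> A \<Longrightarrow> is ! j = is' ! j"
  shows "G is = G is'"
  using assms unfolding depends_on_def by blast

lemma nths_eq_iff:
  assumes "length xs = length ys"
  shows "nths xs A = nths ys A \<longleftrightarrow> (\<forall>j<length xs. j \<in> A \<longrightarrow> xs ! j = ys ! j)"
  using assms
proof (induction xs ys arbitrary: A rule: list_induct2)
  case (Cons x xs y ys)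
  show ?case
    by (auto simp: nths_Cons Cons.IH less_Suc_eq_0_disj)
qed simp

lemma depends_on_nths: "depends_on d A (\<lambda>is. g (nths is A))"
proof (rule depends_onI)
  fix xs ys :: "nat list"
  assume "length xs = d" "length ys = d" "\<And>j. j < d \<Longrightarrow> j \<in> A \<Longrightarrow> xs ! j = ys ! j"
  then have "nths xs A = nths ys A"
    by (subst nths_eq_iff) auto
  then show "g (nths xs A) = g (nths ys A)"
    by simp
qed

lemma depends_on_factor:
  assumes "depends_on d A G"
  obtains g where "\<And>is. length is = d \<Longrightarrow> G is = g (nths is A)"
proof
  fix xs :: "nat list" assume xs: "length xs = d"
  \<comment> \<open>Any list of length \<open>d\<close> with the same sublist serves as
    representative, since \<open>G\<close> cannot tell them apart.\<close>
  define ys where "ys = (SOME ys. length ys = d \<and> nths ys A = nths xs A)"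
  have "length ys = d \<and> nths ys A = nths xs A"
    unfolding ys_def by (rule someI[of _ xs]) (simp add: xs)
  then show "G xs = (\<lambda>zs. G (SOME ys. length ys = d \<and> nths ys A = zs)) (nths xs A)"
    using xs assms unfolding ys_def[symmetric]
    by (auto intro!: depends_onD[OF assms] simp: nths_eq_iff)
qed

lemma tdom_length: "is \<in> tdom d X \<Longrightarrow> length is = d"
  by (simp add: tdom_def)

lemma tdom_nth: "is \<in> tdom d X \<Longrightarrow> j < d \<Longrightarrow> is ! j \<in> X j"
  by (simp add: tdom_def)

lemma tdom_eqI: "xs \<in> tdom d X \<Longrightarrow> ys \<in> tdom d Y \<Longrightarrow> (\<And>j. j < d \<Longrightarrow> xs ! j = ys ! j) \<Longrightarrow> xs = ys"
  by (auto simp: tdom_def intro: nth_equalityI)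

lemma
  assumes "\<And>j. j < d \<Longrightarrow> finite (X j)"
  shows finite_tdom: "finite (tdom d X)"
    and card_tdom_le: "card (tdom d X) \<le> (\<Prod>j<d. card (X j))"
proof -
  let ?f = "\<lambda>xs. \<lambda>j\<in>{..<d}. xs ! j"
  have inj: "inj_on ?f (tdom d X)"
  proof (rule inj_onI)
    fix xs ys assume *: "xs \<in> tdom d X" "ys \<in> tdom d X" "?f xs = ?f ys"
    have "xs ! j = ys ! j" if "j < d" for j
      using fun_cong[OF *(3), of j] that by simp
    with * show "xs = ys" by (blast intro: tdom_eqI)
  qed
  have sub: "?f ` tdom d X \<subseteq> PiE {..<d} X"
    by (rule image_subsetI) (simp add: tdom_def restrict_PiE_iff)
  have fin: "finite (PiE {..<d} X)"
    using assms by (intro finite_PiE) auto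
  show "finite (tdom d X)"
    using inj_on_finite[OF inj sub fin] .
  show "card (tdom d X) \<le> (\<Prod>j<d. card (X j))"
    using card_inj_on_le[OF inj sub fin] by (simp add: card_PiE)
qed

section \<open>Split products and bounds on the partition rank\<close>

lemma prk_one_onI:
  assumes "A \<noteq> {}" "A \<subset> {..<d}" "depends_on d A G" "depends_on d ({..<d} - A) H"
    and "\<And>is. is \<in> tdom d X \<Longrightarrow> t is = G is * H is"
  shows "prk_one_on d X t"
proof -
  obtain g where "\<And>is. length is = d \<Longrightarrow> G is = g (nths is A)"
    using depends_on_factor[OF assms(3)] by blast
  moreover obtain h where "\<And>is. length is = d \<Longrightarrow> H is = h (nths is ({..<d} - A))"
    using depends_on_factor[OF assms(4)] by blast
  ultimately show ?thesis
    using assms unfolding prk_one_on_def by (metis tdom_length)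
qed

lemma prk_one_on_iff:
  "prk_one_on d X t \<longleftrightarrow> (\<exists>A G H. A \<noteq> {} \<and> A \<subset> {..<d} \<and> depends_on d A G \<and> depends_on d ({..<d} - A) H \<and>
     (\<forall>is\<in>tdom d X. t is = G is * H is))"
proof
  assume "prk_one_on d X t"
  then obtain A g h where "A \<noteq> {}" "A \<subset> {..<d}"
    "\<forall>is\<in>tdom d X. t is = g (nths is A) * h (nths is ({..<d} - A))"
    unfolding prk_one_on_def by blast
  then show "\<exists>A G H. A \<noteq> {} \<and> A \<subset> {..<d} \<and> depends_on d A G \<and> depends_on d ({..<d} - A) H \<and>
     (\<forall>is\<in>tdom d X. t is = G is * H is)"
    by (intro exI[of _ A] exI[of _ "\<lambda>is. g (nths is A)"] exI[of _ "\<lambda>is. h (nths is ({..<d} - A))"])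
      (simp add: depends_on_nths)
qed (auto intro: prk_one_onI)

lemma prk_one_on_zero:
  assumes "d \<ge> 2"
  shows "prk_one_on d X (\<lambda>_. 0)"
proof (rule prk_one_onI[where A = "{0}" and G = "\<lambda>_. 0" and H = "\<lambda>_. 0"])
  show "{0} \<subset> {..<d}"
    using assms by (auto simp: psubset_eq set_eq_iff intro!: exI[of _ 1])
qed (auto intro: depends_onI)

text \<open>Allows the summands to be indexed by any finite set of at most \<open>R\<close>
  elements. The missing ones are filled up by zero, which is a split product because
  \<open>d \<ge> 2\<close> leaves room for a nonempty proper set of coordinates.\<close>

lemma prk_le_onI:
  assumes d: "d \<ge> 2" and fin: "finite I" and card: "card I \<le> R"
    and one: "\<And>k. k \<in> I \<Longrightarrow> prk_one_on d X (t k)"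
    and T: "\<And>is. is \<in> tdom d X \<Longrightarrow> T is = (\<Sum>k\<in>I. t k is)"
  shows "prk_le_on d X T R"
proof -
  obtain b where b: "bij_betw b {..<card I} I"
    using ex_bij_betw_nat_finite[OF fin] by (auto simp: atLeast0LessThan)
  define ts where "ts k = (if k < card I then t (b k) else (\<lambda>_. 0))" for k
  have "prk_one_on d X (ts k)" for k
    using b one prk_one_on_zero[OF d] by (auto simp: ts_def bij_betw_def)
  moreover have "T is = (\<Sum>k<R. ts k is)" if "is \<in> tdom d X" for "is"
  proof -
    have "(\<Sum>k<R. ts k is) = (\<Sum>k<card I. ts k is)"
      using card by (intro sum.mono_neutral_right) (auto simp: ts_def)
    also have "\<dots> = (\<Sum>k<card I. t (b k) is)"
      by (simp add: ts_def)
    also have "\<dots> = (\<Sum>k\<in>I. t k is)"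
      using b by (intro sum.reindex_bij_betw)
    finally show ?thesis
      using T[OF that] by simp
  qed
  ultimately show ?thesis
    unfolding prk_le_on_def by blast
qed

lemma prk_le_onE:
  assumes "prk_le_on d X T R"
  obtains ts where "\<And>k. k < R \<Longrightarrow> prk_one_on d X (ts k)"
    and "\<And>is. is \<in> tdom d X \<Longrightarrow> T is = (\<Sum>k<R. ts k is)"
  using assms unfolding prk_le_on_def by blast

lemma prk_le_on_mono:
  assumes "d \<ge> 2" "prk_le_on d X T R" "R \<le> R'"
  shows "prk_le_on d X T R'"
proof -
  obtain ts where "\<And>k. k < R \<Longrightarrow> prk_one_on d X (ts k)"
    "\<And>is. is \<in> tdom d X \<Longrightarrow> T is = (\<Sum>k<R. ts k is)"
    using assms(2) by (metis prk_le_onE)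
  then show ?thesis
    using assms by (intro prk_le_onI[where I = "{..<R}" and t = ts]) auto
qed

lemma prk_le_on_add:
  assumes "d \<ge> 2" "prk_le_on d X S a" "prk_le_on d X T b"
  shows "prk_le_on d X (\<lambda>is. S is + T is) (a + b)"
proof -
  obtain s t where "\<And>k. k < a \<Longrightarrow> prk_one_on d X (s k)"
    "\<And>is. is \<in> tdom d X \<Longrightarrow> S is = (\<Sum>k<a. s k is)"
    "\<And>k. k < b \<Longrightarrow> prk_one_on d X (t k)"
    "\<And>is. is \<in> tdom d X \<Longrightarrow> T is = (\<Sum>k<b. t k is)"
    using assms(2,3) by (metis prk_le_onE)
  then show ?thesis
    using assms(1)
    by (intro prk_le_onI[where I = "{..<a} <+> {..<b}" and t = "case_sum s t"])
      (auto simp: card_Plus sum.Plus)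
qed

lemma prk_le_on_cong:
  assumes "\<And>is. is \<in> tdom d X \<Longrightarrow> S is = T is"
  shows "prk_le_on d X S R \<longleftrightarrow> prk_le_on d X T R"
  unfolding prk_le_on_def using assms by simp

text \<open>A slice \<open>is ! j = y\<close> splits as the indicator of coordinate \<open>j\<close>
  times a function of the others. To count no entry twice, each entry is charged to the first
  \<open>j\<close> with \<open>is ! j \<in> Y j\<close>.\<close>

lemma prk_le_on_slices:
  fixes T :: "nat list \<Rightarrow> 'a::field"
  assumes d: "d \<ge> 2" and fin: "\<And>j. j < d \<Longrightarrow> finite (Y j)"
  shows "prk_le_on d X (\<lambda>is. if \<exists>j<d. is ! j \<in> Y j then T is else 0) (\<Sum>j<d. card (Y j))"
proof (rule prk_le_onI[where I = "SIGMA j:{..<d}. Y j" and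
      t = "\<lambda>(j, y) is. if is ! j = y \<and> (\<forall>k<j. is ! k \<notin> Y k) then T is else 0"])
  fix p assume p: "p \<in> (SIGMA j:{..<d}. Y j)"
  obtain j y where jy: "p = (j, y)" "j < d"
    using p by auto
  \<comment> \<open>Overwriting coordinate \<open>j\<close> by \<open>y\<close> changes nothing on
    the slice and removes the dependence on that coordinate.\<close>
  define H where "H is = (if \<forall>k<j. is ! k \<notin> Y k then T (is[j := y]) else 0)" for "is"
  have "prk_one_on d X (\<lambda>is. if is ! j = y \<and> (\<forall>k<j. is ! k \<notin> Y k) then T is else 0)"
  proof (rule prk_one_onI[where A = "{j}" and G = "\<lambda>is. if is ! j = y then 1 else 0" and H = H])
    have "(if j = 0 then 1 else 0) \<in> {..<d} - {j}"
      using d by auto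
    then show "{j} \<subset> {..<d}"
      using jy by auto
    show "depends_on d {j} (\<lambda>is. if is ! j = y then 1 else (0 :: 'a))"
      using jy by (intro depends_onI) auto
    show "depends_on d ({..<d} - {j}) H"
    proof (rule depends_onI)
      fix xs ys :: "nat list"
      assume l: "length xs = d" "length ys = d"
        and *: "\<And>k. k < d \<Longrightarrow> k \<in> {..<d} - {j} \<Longrightarrow> xs ! k = ys ! k"
      have "xs[j := y] = ys[j := y]"
        using l * jy by (intro nth_equalityI) (auto simp: nth_list_update)
      moreover have "(\<forall>k<j. xs ! k \<notin> Y k) \<longleftrightarrow> (\<forall>k<j. ys ! k \<notin> Y k)"
        using jy * by auto
      ultimately show "H xs = H ys"
        unfolding H_def by (simp only:)
    qed
  qed (auto simp: H_def)
  then show "prk_one_on d X ((\<lambda>(j, y) is. if is ! j = y \<and> (\<forall>k<j. is ! k \<notin> Y k) then T is else 0) p)"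
    by (simp add: jy)
next
  fix "is" assume "is \<in> tdom d X"
  let ?P = "\<lambda>j. is ! j \<in> Y j \<and> (\<forall>k<j. is ! k \<notin> Y k)"
  have "(\<Sum>p\<in>(SIGMA j:{..<d}. Y j). (\<lambda>(j, y) is. if is ! j = y \<and> (\<forall>k<j. is ! k \<notin> Y k) then T is else 0) p is)
      = (\<Sum>j<d. \<Sum>y\<in>Y j. if is ! j = y \<and> (\<forall>k<j. is ! k \<notin> Y k) then T is else 0)"
    using fin by (subst sum.Sigma) (auto intro!: sum.cong)
  also have "\<dots> = (\<Sum>j<d. if ?P j then T is else 0)"
  proof (intro sum.cong refl)
    fix j assume "j \<in> {..<d}"
    then have "(\<Sum>y\<in>Y j. if is ! j = y \<and> Q then T is else 0) = (if is ! j \<in> Y j \<and> Q then T is else 0)" for Q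
      using fin by (cases Q) (simp_all add: sum.delta')
    then show "(\<Sum>y\<in>Y j. if is ! j = y \<and> (\<forall>k<j. is ! k \<notin> Y k) then T is else 0) = (if ?P j then T is else 0)" .
  qed
  also have "\<dots> = (if \<exists>j<d. is ! j \<in> Y j then T is else 0)"
  proof (cases "\<exists>j<d. is ! j \<in> Y j")
    case True
    define j where "j = (LEAST j. is ! j \<in> Y j)"
    from True obtain j1 where "j1 < d" "is ! j1 \<in> Y j1" by blast
    then have "j < d"
      using Least_le[of "\<lambda>j. is ! j \<in> Y j" j1] by (simp add: j_def)
    moreover have j: "?P j"
      using LeastI[of "\<lambda>j. is ! j \<in> Y j" j1] \<open>is ! j1 \<in> Y j1\<close> not_less_Least
      unfolding j_def by blast
    moreover have "?P k \<longleftrightarrow> k = j" for k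
      using j by (meson linorder_neqE_nat)
    ultimately show ?thesis
      using True by simp
  qed (auto intro: sum.neutral)
  finally show "(if \<exists>j<d. is ! j \<in> Y j then T is else 0) =
     (\<Sum>p\<in>(SIGMA j:{..<d}. Y j). (\<lambda>(j, y) is. if is ! j = y \<and> (\<forall>k<j. is ! k \<notin> Y k) then T is else 0) p is)"
    by simp
qed (use d fin in auto)

text \<open>The least element in \<open>prk_on\<close> is attained once some bound exists; covering
  the whole box by slices, with \<open>Y = X\<close>, supplies one.\<close>

lemma prk_le_on_prk_on:
  assumes "d \<ge> 2" "\<And>j. j < d \<Longrightarrow> finite (X j)"
  shows "prk_le_on d X T (prk_on d X T)"
proof -
  have "\<exists>j<d. is ! j \<in> X j" if "is \<in> tdom d X" for "is"
    using assms(1) that by (intro exI[of _ 0]) (auto simp: tdom_def)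
  then have "prk_le_on d X T (\<Sum>j<d. card (X j))"
    using prk_le_on_slices[of d X X T, OF assms]
    by (subst prk_le_on_cong[where T = "\<lambda>is. if \<exists>j<d. is ! j \<in> X j then T is else 0"]) auto
  then show ?thesis
    unfolding prk_on_def by (rule LeastI)
qed

lemma prk_on_le: "prk_le_on d X T R \<Longrightarrow> prk_on d X T \<le> R"
  unfolding prk_on_def by (rule Least_le)

section \<open>Pullback and contraction of tensors\<close>

definition pull :: "nat \<Rightarrow> (nat \<Rightarrow> nat \<Rightarrow> nat) \<Rightarrow> nat list \<Rightarrow> nat list" where
  "pull d \<phi> is = map (\<lambda>j. \<phi> j (is ! j)) [0..<d]"

lemma length_pull [simp]: "length (pull d \<phi> is) = d"
  by (simp add: pull_def)

lemma nth_pull [simp]: "j < d \<Longrightarrow> pull d \<phi> is ! j = \<phi> j (is ! j)"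
  by (simp add: pull_def)

text \<open>Relabelling acts on each coordinate separately, so a factor reading only the coordinates
  in \<open>A\<close> still does so afterwards.\<close>

lemma prk_le_on_pull:
  assumes "d \<ge> 2" "prk_le_on d (\<lambda>j. \<phi> j ` X j) T R"
  shows "prk_le_on d X (\<lambda>is. T (pull d \<phi> is)) R"
proof -
  let ?Y = "\<lambda>j. \<phi> j ` X j"
  obtain ts where "(\<forall>k<R. prk_one_on d ?Y (ts k)) \<and> (\<forall>is\<in>tdom d ?Y. T is = (\<Sum>k<R. ts k is))"
    using assms(2) unfolding prk_le_on_def ..
  then have ts: "\<And>k. k < R \<Longrightarrow> prk_one_on d ?Y (ts k)"
    "\<And>is. is \<in> tdom d ?Y \<Longrightarrow> T is = (\<Sum>k<R. ts k is)"
    by auto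
  have mem: "pull d \<phi> is \<in> tdom d ?Y" if "is \<in> tdom d X" for "is"
    using that by (auto simp: tdom_def)
  have dep: "depends_on d A (\<lambda>is. G (pull d \<phi> is))" if "depends_on d A G" for A and G :: "nat list \<Rightarrow> 'a"
    by (rule depends_onI, rule depends_onD[OF that]) simp_all
  show ?thesis
  proof (rule prk_le_onI[where I = "{..<R}" and t = "\<lambda>k is. ts k (pull d \<phi> is)"])
    fix k assume "k \<in> {..<R}"
    then have "prk_one_on d ?Y (ts k)"
      using ts(1) by simp
    then obtain A G H where "A \<noteq> {} \<and> A \<subset> {..<d} \<and> depends_on d A G \<and> depends_on d ({..<d} - A) H \<and>
      (\<forall>is\<in>tdom d ?Y. ts k is = G is * H is)"
      unfolding prk_one_on_iff by (elim exE)
    then show "prk_one_on d X (\<lambda>is. ts k (pull d \<phi> is))"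
      using mem dep
      by (intro prk_one_onI[where A = A and G = "\<lambda>is. G (pull d \<phi> is)" and H = "\<lambda>is. H (pull d \<phi> is)"])
        auto
  qed (use assms ts mem in auto)
qed

text \<open>Distributivity: an index of the box is a pair of partial indices. Partial indices are
  kept as lists of length \<open>d\<close> whose irrelevant coordinates hold the dummy value
  0.\<close>

lemma sum_tdom_split:
  fixes G H :: "nat list \<Rightarrow> 'a::comm_semiring_1"
  assumes "depends_on d A G" "depends_on d ({..<d} - A) H"
  shows "(\<Sum>a\<in>tdom d Z. G a * H a) =
    (\<Sum>a\<in>tdom d (\<lambda>j. if j \<in> A then Z j else {0}). G a) *
    (\<Sum>a\<in>tdom d (\<lambda>j. if j \<notin> A then Z j else {0}). H a)"
proof -
  let ?P = "tdom d (\<lambda>j. if j \<in> A then Z j else {0})" and ?Q = "tdom d (\<lambda>j. if j \<notin> A then Z j else {0})"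
  let ?mask = "\<lambda>B a. map (\<lambda>j. if j \<in> B then a ! j else (0::nat)) [0..<d]"
  let ?merge = "\<lambda>(a, b). map (\<lambda>j. if j \<in> A then a ! j else b ! j) [0..<d]"
  have "(\<Sum>a\<in>?P. G a) * (\<Sum>a\<in>?Q. H a) = (\<Sum>(a, b)\<in>?P \<times> ?Q. G a * H b)"
    by (simp add: sum_product sum.cartesian_product)
  also have "\<dots> = (\<Sum>a\<in>tdom d Z. G a * H a)"
  proof (rule sum.reindex_bij_witness[where i = "\<lambda>a. (?mask A a, ?mask (- A) a)" and j = ?merge])
    fix p assume "p \<in> ?P \<times> ?Q"
    then obtain a b where p: "p = (a, b)" "a \<in> ?P" "b \<in> ?Q" by auto
    have "G (?merge p) = G a" "H (?merge p) = H b"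
      unfolding p(1) using p(2,3)
      by (auto intro!: depends_onD[OF assms(1)] depends_onD[OF assms(2)] simp: tdom_def)
    then show "G (?merge p) * H (?merge p) = (case p of (a, b) \<Rightarrow> G a * H b)"
      by (simp add: p)
    show "(?mask A (?merge p), ?mask (- A) (?merge p)) = p"
      unfolding p(1) using p(2,3)
      by (auto simp: tdom_def intro!: nth_equalityI split: if_splits)
    show "?merge p \<in> tdom d Z"
      unfolding p(1) using p(2,3) by (auto simp: tdom_def split: if_splits)
  qed (auto simp: tdom_def intro!: nth_equalityI)
  finally show ?thesis by simp
qed

lemma tdom_cong: "(\<And>j. j < d \<Longrightarrow> X j = Y j) \<Longrightarrow> tdom d X = tdom d Y"
  by (auto simp: tdom_def)

text \<open>The range of summation is a box whose side \<open>j\<close> depends on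
  \<open>is ! j\<close> alone. Summing a split product over it therefore gives a product split along
  the same \<open>A\<close>, by \<open>sum_tdom_split\<close>.\<close>

lemma prk_le_on_contract:
  assumes "d \<ge> 2" "prk_le_on d X S R" and sub: "\<And>j i. j < d \<Longrightarrow> Z j i \<subseteq> X j"
  shows "prk_le_on d W (\<lambda>is. \<Sum>a\<in>tdom d (\<lambda>j. Z j (is ! j)). S a) R"
proof -
  let ?c = "\<lambda>(t :: nat list \<Rightarrow> 'a) is. \<Sum>a\<in>tdom d (\<lambda>j. Z j (is ! j)). t a"
  obtain ts where ts: "\<And>k. k < R \<Longrightarrow> prk_one_on d X (ts k)"
    "\<And>is. is \<in> tdom d X \<Longrightarrow> S is = (\<Sum>k<R. ts k is)"
    using assms(2) by (metis prk_le_onE)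
  have mem: "a \<in> tdom d X" if "a \<in> tdom d (\<lambda>j. Z j (is ! j))" for a "is"
    using that sub by (fastforce simp: tdom_def)
  show ?thesis
  proof (rule prk_le_onI[where I = "{..<R}" and t = "\<lambda>k. ?c (ts k)"])
    fix k assume "k \<in> {..<R}"
    then have "prk_one_on d X (ts k)"
      using ts(1) by simp
    then obtain A G H where "A \<noteq> {} \<and> A \<subset> {..<d} \<and> depends_on d A G \<and> depends_on d ({..<d} - A) H \<and>
      (\<forall>is\<in>tdom d X. ts k is = G is * H is)"
      unfolding prk_one_on_iff by (elim exE)
    then have A: "A \<noteq> {}" "A \<subset> {..<d}" and dep: "depends_on d A G" "depends_on d ({..<d} - A) H"
      and GH: "\<And>is. is \<in> tdom d X \<Longrightarrow> ts k is = G is * H is"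
      by blast+
    show "prk_one_on d W (?c (ts k))"
    proof (rule prk_one_onI[OF A])
      show "depends_on d A (\<lambda>is. \<Sum>a\<in>tdom d (\<lambda>j. if j \<in> A then Z j (is ! j) else {0}). G a)"
        by (intro depends_onI sum.cong tdom_cong) auto
      show "depends_on d ({..<d} - A) (\<lambda>is. \<Sum>a\<in>tdom d (\<lambda>j. if j \<notin> A then Z j (is ! j) else {0}). H a)"
        by (intro depends_onI sum.cong tdom_cong) auto
      fix "is"
      have "?c (ts k) is = ?c (\<lambda>a. G a * H a) is"
        using mem GH by (intro sum.cong) auto
      then show "?c (ts k) is = (\<Sum>a\<in>tdom d (\<lambda>j. if j \<in> A then Z j (is ! j) else {0}). G a) *
          (\<Sum>a\<in>tdom d (\<lambda>j. if j \<notin> A then Z j (is ! j) else {0}). H a)"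
        using sum_tdom_split[OF dep] by simp
    qed
  next
    fix "is"
    have "?c S is = ?c (\<lambda>a. \<Sum>k<R. ts k a) is"
      using mem ts(2) by (intro sum.cong) auto
    also have "\<dots> = (\<Sum>k<R. ?c (ts k) is)"
      by (rule sum.swap)
    finally show "?c S is = (\<Sum>k<R. ?c (ts k) is)" .
  qed (use assms in auto)
qed

section \<open>Forms supported on matchings\<close>

definition matchings :: "nat \<Rightarrow> nat \<Rightarrow> nat list set set" where
  "matchings d m = {M. M \<subseteq> tdom d (\<lambda>_. {..<m}) \<and> (\<forall>j<d. bij_betw (\<lambda>e. e ! j) M {..<m})}"

text \<open>These are the polynomials in the entries that have degree one in every slice of the box.
  For \<open>d = 2\<close> the matchings are permutation matrices, and the determinant is an
  example.\<close>

definition mform :: "nat \<Rightarrow> nat \<Rightarrow> (nat list set \<Rightarrow> 'a::field) \<Rightarrow> (nat list \<Rightarrow> 'a) \<Rightarrow> 'a" where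
  "mform d m c S = (\<Sum>M\<in>matchings d m. c M * (\<Prod>e\<in>M. S e))"

lemma finite_matchings: "finite (matchings d m)"
  by (rule finite_subset[of _ "Pow (tdom d (\<lambda>_. {..<m}))"]) (auto simp: matchings_def finite_tdom)

lemma matchings_subset: "M \<in> matchings d m \<Longrightarrow> e \<in> M \<Longrightarrow> e \<in> tdom d (\<lambda>_. {..<m})"
  by (auto simp: matchings_def)

lemma finite_matching: "M \<in> matchings d m \<Longrightarrow> finite M"
  by (rule finite_subset[of _ "tdom d (\<lambda>_. {..<m})"]) (auto simp: matchings_def finite_tdom)

lemma matchings_inj: "M \<in> matchings d m \<Longrightarrow> e \<in> M \<Longrightarrow> e' \<in> M \<Longrightarrow> j < d \<Longrightarrow> e ! j = e' ! j \<Longrightarrow> e = e'"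
  by (auto simp: matchings_def bij_betw_def dest: inj_onD)

lemma matchings_surj:
  assumes "M \<in> matchings d m" "j < d" "a < m"
  obtains e where "e \<in> M" "e ! j = a"
  using assms by (auto simp: matchings_def bij_betw_def) (metis imageE lessThan_iff)

lemma mform_cong:
  assumes "\<And>e. e \<in> tdom d (\<lambda>_. {..<m}) \<Longrightarrow> S e = S' e"
  shows "mform d m c S = mform d m c S'"
  unfolding mform_def using assms
  by (intro sum.cong refl arg_cong2[where f = "(*)"] prod.cong) (auto dest: matchings_subset)

section \<open>Polarisation of a complex polynomial\<close>

lemma prod_of_bool:
  "finite A \<Longrightarrow> (\<Prod>x\<in>A. of_bool (P x)) = (of_bool (\<forall>x\<in>A. P x) :: 'a::comm_semiring_1)"
  by (induction A rule: finite_induct) auto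

text \<open>Inclusion-exclusion: the sum is the expansion of the product over \<open>X\<close> of
  \<open>1 + ?g b\<close>, whose factor is 1 for \<open>b \<in> V\<close> and 0 otherwise.\<close>

lemma alternating_sum_superset:
  assumes "finite X" "V \<subseteq> X"
  shows "(\<Sum>U\<in>Pow X. (\<Prod>b\<in>X - U. - 1) * of_bool (V \<subseteq> U)) = (of_bool (V = X) :: 'a::comm_ring_1)"
proof -
  let ?g = "\<lambda>b. if b \<in> V then 0 else (- 1 :: 'a)"
  have "(\<Prod>b\<in>X - U. - 1) * of_bool (V \<subseteq> U) = (\<Prod>b\<in>U. 1) * (\<Prod>b\<in>X - U. ?g b)" for U
  proof (cases "V \<subseteq> U")
    case True
    then have "(\<Prod>b\<in>X - U. ?g b) = (\<Prod>b\<in>X - U. - 1)"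
      by (intro prod.cong) auto
    then show ?thesis using True by simp
  next
    case False
    then obtain b where "b \<in> V" "b \<notin> U" by blast
    then have "(\<Prod>b\<in>X - U. ?g b) = 0"
      using assms by (intro prod_zero) auto
    then show ?thesis using False by simp
  qed
  then have "(\<Sum>U\<in>Pow X. (\<Prod>b\<in>X - U. - 1) * of_bool (V \<subseteq> U)) = (\<Prod>b\<in>X. 1 + ?g b)"
    unfolding prod_add[OF assms(1)] by (intro sum.cong refl)
  also have "\<dots> = (\<Prod>b\<in>X. of_bool (b \<in> V))"
    by (intro prod.cong) auto
  also have "\<dots> = of_bool (V = X)"
    using assms by (subst prod_of_bool) auto
  finally show ?thesis .
qed

text \<open>Listing the variables with multiplicity turns a product of powers into a product over
  positions, which can be expanded by choosing one summand per position.\<close>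

lemma monomial_factor_list:
  fixes mon :: "nat list \<Rightarrow>\<^sub>0 nat"
  shows "\<exists>ws. (\<forall>u. count (mset ws) u = Poly_Mapping.lookup mon u)
    \<and> set ws = Poly_Mapping.keys mon \<and> length ws = mono_deg mon
    \<and> (\<forall>x :: nat list \<Rightarrow> complex.
        (\<Prod>v\<in>Poly_Mapping.keys mon. x v ^ Poly_Mapping.lookup mon v) = (\<Prod>l<length ws. x (ws ! l)))"
proof -
  have "finite {v. 0 < Poly_Mapping.lookup mon v}"
    using finite_keys[of mon] by (simp add: keys_def)
  then have cnt: "count (Abs_multiset (Poly_Mapping.lookup mon)) = Poly_Mapping.lookup mon"
    by simp
  obtain ws where ws: "mset ws = Abs_multiset (Poly_Mapping.lookup mon)"
    using ex_mset by blast
  have set: "set ws = Poly_Mapping.keys mon"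
    by (simp flip: set_mset_mset add: ws set_mset_def cnt keys_def)
  have "length ws = size (mset ws)"
    by simp
  also have "\<dots> = mono_deg mon"
    unfolding size_multiset_overloaded_eq mono_deg_def by (simp add: set) (simp add: ws cnt)
  finally have len: "length ws = mono_deg mon" .
  have "(\<Prod>v\<in>Poly_Mapping.keys mon. x v ^ Poly_Mapping.lookup mon v) = (\<Prod>l<length ws. x (ws ! l))"
    for x :: "nat list \<Rightarrow> complex"
  proof -
    have "(\<Prod>v\<in>Poly_Mapping.keys mon. x v ^ Poly_Mapping.lookup mon v) = prod_mset (image_mset x (mset ws))"
      unfolding image_prod_mset_multiplicity by (simp add: set) (simp add: ws cnt)
    also have "\<dots> = prod_list (map x ws)"
      by (simp flip: prod_mset_prod_list)
    also have "\<dots> = (\<Prod>l<length ws. x (ws ! l))"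
      by (simp add: prod.list_conv_set_nth atLeast0LessThan)
    finally show ?thesis .
  qed
  then show ?thesis
    using ws set len cnt by (intro exI[of _ ws]) simp
qed

text \<open>The alternating sum over the restrictions of a tensor to the boxes
  \<open>U 0 \<times> ... \<times> U (d-1)\<close> extracts the part of \<open>f\<close> that involves each of the
  \<open>m\<close> coordinate values in each direction. The tensor on \<open>[m]\<^sup>d\<close> is first contracted along the maps
  \<open>b \<mapsto> v ! b ! j\<close>, where \<open>v\<close> lists the variables of a monomial of degree \<open>m\<close> of \<open>f\<close>,
  so that the diagonal matching only arises from that monomial.\<close>

lemma complex_poly_imp_mform:
  fixes f :: cpoly
  assumes d: "d \<ge> 2"
    and f: "f \<noteq> 0" "total_degree f = m" "poly_vars f \<subseteq> tdom d (\<lambda>j. {..<n0 j})"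
    and van: "\<And>S. prk_le_on d (\<lambda>j. {..<n0 j}) S r \<Longrightarrow> peval f S = 0"
  shows "\<exists>c :: nat list set \<Rightarrow> complex.
    (\<exists>M\<in>matchings d m. c M \<noteq> 0) \<and> (\<forall>S. prk_le_on d (\<lambda>_. {..<m}) S r \<longrightarrow> mform d m c S = 0)"
proof -
  let ?D = "tdom d (\<lambda>_. {..<m})"
  let ?PU = "PiE {..<d} (\<lambda>_. Pow {..<m})"
  let ?K = "Poly_Mapping.keys f"
  let ?cf = "Poly_Mapping.lookup f"
  have finD: "finite ?D"
    by (rule finite_tdom) simp
  have "\<exists>w. \<forall>mon. (\<forall>u. count (mset (w mon)) u = Poly_Mapping.lookup mon u)
    \<and> set (w mon) = Poly_Mapping.keys mon \<and> length (w mon) = mono_deg mon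
    \<and> (\<forall>x :: nat list \<Rightarrow> complex. (\<Prod>v\<in>Poly_Mapping.keys mon. x v ^ Poly_Mapping.lookup mon v)
         = (\<Prod>l<length (w mon). x (w mon ! l)))"
    by (rule choice) (intro allI monomial_factor_list)
  then obtain w where w: "\<forall>mon. (\<forall>u. count (mset (w mon)) u = Poly_Mapping.lookup mon u)
    \<and> set (w mon) = Poly_Mapping.keys mon \<and> length (w mon) = mono_deg mon
    \<and> (\<forall>x :: nat list \<Rightarrow> complex. (\<Prod>v\<in>Poly_Mapping.keys mon. x v ^ Poly_Mapping.lookup mon v)
         = (\<Prod>l<length (w mon). x (w mon ! l)))" ..
  have w_count: "\<And>mon u. count (mset (w mon)) u = Poly_Mapping.lookup mon u"
    and w_set: "\<And>mon. set (w mon) = Poly_Mapping.keys mon"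
    and w_len: "\<And>mon. length (w mon) = mono_deg mon"
    and w_prod: "\<And>mon (x :: nat list \<Rightarrow> complex). (\<Prod>v\<in>Poly_Mapping.keys mon. x v ^ Poly_Mapping.lookup mon v)
         = (\<Prod>l<length (w mon). x (w mon ! l))"
    using w by simp_all
  have finK: "finite ?K" and neK: "?K \<noteq> {}"
    using f(1) by auto
  have deg_le: "length (w mon) \<le> m" if "mon \<in> ?K" for mon
    using that finK f(2) unfolding w_len total_degree_def by auto
  have "Max (mono_deg ` ?K) \<in> mono_deg ` ?K"
    using finK neK by (intro Max_in) auto
  then have "m \<in> mono_deg ` ?K"
    by (simp only: f(2)[unfolded total_degree_def])
  then obtain mon0 where mon0: "mon0 \<in> ?K" "mono_deg mon0 = m"
    by blast
  define v where "v = w mon0"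
  have len_v: "length v = m"
    by (simp add: v_def w_len mon0)
  have w_nth_len: "length (w mon ! l) = d" if "mon \<in> ?K" "l < length (w mon)" for mon l
  proof -
    have "w mon ! l \<in> Poly_Mapping.keys mon"
      using that(2) nth_mem by (fastforce simp flip: w_set)
    then have "w mon ! l \<in> poly_vars f"
      using that(1) unfolding poly_vars_def by blast
    then show ?thesis
      using f(3) by (blast intro: tdom_length)
  qed
  \<comment> \<open>The positions of the box that the contraction sums into the entry
    \<open>i\<close>.\<close>
  define fib where "fib i = {a \<in> ?D. \<forall>j<d. v ! (a ! j) ! j = i ! j}" for i
  have fin_fib: "finite (fib i)" for i
    using finD by (simp add: fib_def)
  \<comment> \<open>The choices of one position per factor of \<open>mon\<close> that use all
    \<open>m\<close> values in every direction; exactly these survive the alternating sum.\<close>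
  define Q where "Q mon = {\<alpha> \<in> PiE {..<length (w mon)} (\<lambda>l. fib (w mon ! l)).
      \<forall>j<d. (\<lambda>l. \<alpha> l ! j) ` {..<length (w mon)} = {..<m}}" for mon
  have finQ: "finite (Q mon)" for mon
    unfolding Q_def by (rule finite_subset[OF Collect_restrict]) (intro finite_PiE fin_fib, simp)
  have Q_inj: "length (w mon) = m" "inj_on \<alpha> {..<length (w mon)}" "\<alpha> ` {..<length (w mon)} \<in> matchings d m"
    if "mon \<in> ?K" "\<alpha> \<in> Q mon" for mon \<alpha>
  proof -
    let ?k = "length (w mon)"
    have surj: "(\<lambda>l. \<alpha> l ! j) ` {..<?k} = {..<m}" if "j < d" for j
      using \<open>\<alpha> \<in> Q mon\<close> that by (simp add: Q_def)
    \<comment> \<open>Covering \<open>m\<close> values takes at least \<open>m\<close> factors, and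
      \<open>m\<close> is the top degree. So only monomials of degree \<open>m\<close> contribute,
      and every coordinate of the choice is a bijection, which makes its image a matching.\<close>
    have "m \<le> ?k"
      using card_image_le[of "{..<?k}" "\<lambda>l. \<alpha> l ! 0"] surj[of 0] d by simp
    then show k: "?k = m"
      using deg_le[OF that(1)] by simp
    have inj: "inj_on (\<lambda>l. \<alpha> l ! j) {..<?k}" if "j < d" for j
      using surj[OF that] k by (intro eq_card_imp_inj_on) auto
    show "inj_on \<alpha> {..<?k}"
      using inj[of 0] d by (auto simp: inj_on_def)
    have "bij_betw (\<lambda>e. e ! j) (\<alpha> ` {..<?k}) {..<m}" if "j < d" for j
      unfolding bij_betw_def
    proof
      show "inj_on (\<lambda>e. e ! j) (\<alpha> ` {..<?k})"
        using inj[OF that] by (auto simp: inj_on_def)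
      show "(\<lambda>e. e ! j) ` \<alpha> ` {..<?k} = {..<m}"
        using surj[OF that] by (simp add: image_image)
    qed
    moreover have "\<alpha> ` {..<?k} \<subseteq> ?D"
      using \<open>\<alpha> \<in> Q mon\<close> by (auto simp: Q_def fib_def PiE_def Pi_def)
    ultimately show "\<alpha> ` {..<?k} \<in> matchings d m"
      by (simp add: matchings_def)
  qed
  define N where "N mon M = {\<alpha> \<in> Q mon. \<alpha> ` {..<length (w mon)} = M}" for mon M
  define c where "c M = (\<Sum>mon\<in>?K. ?cf mon * of_nat (card (N mon M)))" for M
  have van_c: "mform d m c S = 0" if S: "prk_le_on d (\<lambda>_. {..<m}) S r" for S
  proof -
    \<comment> \<open>The contraction of \<open>S\<close> restricted to the box with sides
      \<open>U j\<close>. Its rank is still at most \<open>r\<close>, so \<open>f\<close> vanishes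
      on it for every \<open>U\<close>.\<close>
    define x where "x U i = (\<Sum>a\<in>tdom d (\<lambda>j. {b. b \<in> U j \<and> b < m \<and> v ! b ! j = i ! j}). S a)" for U i
    define sg where "sg U = (\<Prod>b\<in>{..<m} - U. (- 1 :: complex))" for U
    have "prk_le_on d (\<lambda>j. {..<n0 j}) (x U) r" for U
      unfolding x_def
      using prk_le_on_contract[OF d S, where Z = "\<lambda>j y. {b. b \<in> U j \<and> b < m \<and> v ! b ! j = y}"] by auto
    then have peval_x: "peval f (x U) = 0" for U
      by (rule van)
    have x_eq: "x U i = (\<Sum>a\<in>fib i. (\<Prod>j<d. of_bool (a ! j \<in> U j)) * S a)" for U i
    proof -
      have "x U i = (\<Sum>a\<in>fib i \<inter> {a. \<forall>j\<in>{..<d}. a ! j \<in> U j}. S a)"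
        unfolding x_def by (intro sum.cong refl) (auto simp: fib_def tdom_def)
      also have "\<dots> = (\<Sum>a\<in>fib i. of_bool (\<forall>j\<in>{..<d}. a ! j \<in> U j) * S a)"
        using sum_of_bool_mult_eq[OF fin_fib, of "\<lambda>a. \<forall>j\<in>{..<d}. a ! j \<in> U j" S i] by simp
      finally show ?thesis
        by (simp only: prod_of_bool[OF finite_lessThan])
    qed
    have prod_x: "(\<Prod>l<length (w mon). x U (w mon ! l)) =
        (\<Sum>\<alpha>\<in>PiE {..<length (w mon)} (\<lambda>l. fib (w mon ! l)).
          (\<Prod>j<d. of_bool ((\<lambda>l. \<alpha> l ! j) ` {..<length (w mon)} \<subseteq> U j)) * (\<Prod>l<length (w mon). S (\<alpha> l)))" for U mon
    proof -
      have *: "(\<Prod>l<length (w mon). \<Prod>j<d. of_bool (\<alpha> l ! j \<in> U j)) =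
          (\<Prod>j<d. of_bool ((\<lambda>l. \<alpha> l ! j) ` {..<length (w mon)} \<subseteq> U j) :: complex)" for \<alpha> :: "nat \<Rightarrow> nat list"
        by (subst prod.swap) (simp add: prod_of_bool image_subset_iff)
      show ?thesis
        unfolding x_eq by (subst prod_sum_PiE) (simp_all add: fin_fib prod.distrib *)
    qed
    have sum_U: "(\<Sum>U\<in>?PU. (\<Prod>j<d. sg (U j)) * (\<Prod>j<d. of_bool (V j \<subseteq> U j))) = (of_bool (\<forall>j<d. V j = {..<m}) :: complex)"
      if "\<And>j. j < d \<Longrightarrow> V j \<subseteq> {..<m}" for V
    proof -
      have "(\<Sum>U\<in>?PU. (\<Prod>j<d. sg (U j)) * (\<Prod>j<d. of_bool (V j \<subseteq> U j)))
          = (\<Prod>j<d. \<Sum>U\<in>Pow {..<m}. sg U * of_bool (V j \<subseteq> U))"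
        by (subst prod_sum_PiE) (simp_all add: prod.distrib)
      also have "\<dots> = (\<Prod>j<d. of_bool (V j = {..<m}))"
        unfolding sg_def using that by (intro prod.cong refl alternating_sum_superset) auto
      also have "\<dots> = of_bool (\<forall>j<d. V j = {..<m})"
        by (subst prod_of_bool) auto
      finally show ?thesis .
    qed
    \<comment> \<open>The signed sum of these zeros is computed in a second way: expand each
      monomial into choices, sum over \<open>U\<close> first by inclusion-exclusion, then group the
      remaining choices by their image.\<close>
    have "0 = (\<Sum>U\<in>?PU. (\<Prod>j<d. sg (U j)) * peval f (x U))"
      by (simp add: peval_x)
    also have "\<dots> = (\<Sum>U\<in>?PU. (\<Prod>j<d. sg (U j)) * (\<Sum>mon\<in>?K. ?cf mon * (\<Prod>l<length (w mon). x U (w mon ! l))))"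
      unfolding peval_def w_prod ..
    also have "\<dots> = (\<Sum>mon\<in>?K. ?cf mon * (\<Sum>\<alpha>\<in>PiE {..<length (w mon)} (\<lambda>l. fib (w mon ! l)). (\<Prod>l<length (w mon). S (\<alpha> l)) *
            (\<Sum>U\<in>?PU. (\<Prod>j<d. sg (U j)) * (\<Prod>j<d. of_bool ((\<lambda>l. \<alpha> l ! j) ` {..<length (w mon)} \<subseteq> U j)))))"
    proof -
      have "(\<Sum>U\<in>?PU. (\<Prod>j<d. sg (U j)) * (\<Sum>mon\<in>?K. ?cf mon * (\<Prod>l<length (w mon). x U (w mon ! l))))
        = (\<Sum>mon\<in>?K. \<Sum>U\<in>?PU. (\<Prod>j<d. sg (U j)) * (?cf mon * (\<Prod>l<length (w mon). x U (w mon ! l))))"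
        unfolding sum_distrib_left by (rule sum.swap)
      also have "\<dots> = (\<Sum>mon\<in>?K. \<Sum>\<alpha>\<in>PiE {..<length (w mon)} (\<lambda>l. fib (w mon ! l)). \<Sum>U\<in>?PU.
          (\<Prod>j<d. sg (U j)) * (?cf mon * ((\<Prod>j<d. of_bool ((\<lambda>l. \<alpha> l ! j) ` {..<length (w mon)} \<subseteq> U j)) *
            (\<Prod>l<length (w mon). S (\<alpha> l)))))"
        unfolding prod_x sum_distrib_left by (intro sum.cong refl sum.swap)
      finally show ?thesis
        by (simp only: sum_distrib_left mult_ac)
    qed
    also have "\<dots> = (\<Sum>mon\<in>?K. ?cf mon * (\<Sum>\<alpha>\<in>Q mon. \<Prod>l<length (w mon). S (\<alpha> l)))"
    proof (rule sum.cong[OF refl], rule arg_cong2[where f = "(*)", OF refl])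
      fix mon
      let ?P = "PiE {..<length (w mon)} (\<lambda>l. fib (w mon ! l))"
      have "(\<Sum>\<alpha>\<in>?P. (\<Prod>l<length (w mon). S (\<alpha> l)) *
            (\<Sum>U\<in>?PU. (\<Prod>j<d. sg (U j)) * (\<Prod>j<d. of_bool ((\<lambda>l. \<alpha> l ! j) ` {..<length (w mon)} \<subseteq> U j))))
        = (\<Sum>\<alpha>\<in>?P. (\<Prod>l<length (w mon). S (\<alpha> l)) * of_bool (\<forall>j<d. (\<lambda>l. \<alpha> l ! j) ` {..<length (w mon)} = {..<m}))"
      proof (rule sum.cong[OF refl], rule arg_cong2[where f = "(*)", OF refl], rule sum_U)
        fix \<alpha> j assume "\<alpha> \<in> ?P" "j < d"
        then show "(\<lambda>l. \<alpha> l ! j) ` {..<length (w mon)} \<subseteq> {..<m}"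
          by (auto simp: fib_def tdom_def PiE_def Pi_def)
      qed
      also have "\<dots> = (\<Sum>\<alpha>\<in>?P. of_bool (\<forall>j<d. (\<lambda>l. \<alpha> l ! j) ` {..<length (w mon)} = {..<m}) * (\<Prod>l<length (w mon). S (\<alpha> l)))"
        by (simp only: mult.commute)
      also have "\<dots> = (\<Sum>\<alpha>\<in>?P \<inter> {\<alpha>. \<forall>j<d. (\<lambda>l. \<alpha> l ! j) ` {..<length (w mon)} = {..<m}}. \<Prod>l<length (w mon). S (\<alpha> l))"
        by (rule sum_of_bool_mult_eq) (intro finite_PiE fin_fib finite_lessThan)
      also have "?P \<inter> {\<alpha>. \<forall>j<d. (\<lambda>l. \<alpha> l ! j) ` {..<length (w mon)} = {..<m}} = Q mon"
        by (auto simp: Q_def)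
      finally show "(\<Sum>\<alpha>\<in>?P. (\<Prod>l<length (w mon). S (\<alpha> l)) *
            (\<Sum>U\<in>?PU. (\<Prod>j<d. sg (U j)) * (\<Prod>j<d. of_bool ((\<lambda>l. \<alpha> l ! j) ` {..<length (w mon)} \<subseteq> U j))))
        = (\<Sum>\<alpha>\<in>Q mon. \<Prod>l<length (w mon). S (\<alpha> l))" .
    qed
    also have "\<dots> = (\<Sum>mon\<in>?K. ?cf mon * (\<Sum>M\<in>matchings d m. of_nat (card (N mon M)) * (\<Prod>e\<in>M. S e)))"
    proof (rule sum.cong[OF refl], rule arg_cong2[where f = "(*)", OF refl])
      fix mon assume mon: "mon \<in> ?K"
      let ?im = "\<lambda>\<alpha>. \<alpha> ` {..<length (w mon)}"
      have "(\<Sum>\<alpha>\<in>Q mon. \<Prod>l<length (w mon). S (\<alpha> l)) = (\<Sum>\<alpha>\<in>Q mon. \<Prod>e\<in>?im \<alpha>. S e)"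
        using Q_inj(2)[OF mon] by (intro sum.cong refl) (simp add: prod.reindex)
      also have "\<dots> = (\<Sum>M\<in>matchings d m. \<Sum>\<alpha>\<in>N mon M. \<Prod>e\<in>?im \<alpha>. S e)"
        unfolding N_def using Q_inj(3)[OF mon]
        by (intro sum.group[symmetric] finQ finite_matchings) blast
      also have "\<dots> = (\<Sum>M\<in>matchings d m. \<Sum>\<alpha>\<in>N mon M. \<Prod>e\<in>M. S e)"
        by (intro sum.cong refl) (simp add: N_def)
      finally show "(\<Sum>\<alpha>\<in>Q mon. \<Prod>l<length (w mon). S (\<alpha> l)) =
          (\<Sum>M\<in>matchings d m. of_nat (card (N mon M)) * (\<Prod>e\<in>M. S e))"
        by simp
    qed
    also have "\<dots> = mform d m c S"
      unfolding mform_def c_def sum_distrib_left sum_distrib_right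
      by (subst sum.swap) (simp only: mult.assoc)
    finally show ?thesis by simp
  qed
  define M0 where "M0 = replicate d ` {..<m}"
  have "bij_betw (\<lambda>e. e ! j) M0 {..<m}" if "j < d" for j
    using that by (auto simp: bij_betw_def M0_def inj_on_def image_image)
  then have M0: "M0 \<in> matchings d m"
    by (auto simp: matchings_def M0_def tdom_def)
  \<comment> \<open>All coordinates of an edge of \<open>M0\<close> coincide, so each variable of
    \<open>mon\<close> is an entire entry \<open>v ! \<pi> l\<close>, not a mixture of several. As
    \<open>\<pi>\<close> is a permutation, \<open>mon\<close> and \<open>mon0\<close> have the same
    variables with the same multiplicities.\<close>
  have only: "mon = mon0" if mon: "mon \<in> ?K" and \<alpha>: "\<alpha> \<in> N mon M0" for mon \<alpha>
  proof -
    have \<alpha>Q: "\<alpha> \<in> Q mon" and im: "\<alpha> ` {..<length (w mon)} = M0"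
      using \<alpha> by (auto simp: N_def)
    have len: "length (w mon) = m"
      using Q_inj(1)[OF mon \<alpha>Q] .
    define \<pi> where "\<pi> l = \<alpha> l ! 0" for l
    have \<pi>_im: "\<pi> ` {..<m} = {..<m}"
      using \<alpha>Q d len by (auto simp: Q_def \<pi>_def)
    then have \<pi>_inj: "inj_on \<pi> {..<m}"
      by (intro eq_card_imp_inj_on) auto
    have nth: "w mon ! l = v ! \<pi> l" if l: "l < m" for l
    proof (rule nth_equalityI)
      have "\<alpha> l \<in> M0"
        using im l len by blast
      then have rep: "\<alpha> l = replicate d (\<pi> l)"
        using d by (auto simp: M0_def \<pi>_def)
      have \<pi>l: "\<pi> l < m"
        using \<pi>_im l by blast
      have "length (v ! \<pi> l) = d"
        using w_nth_len[OF mon0(1)] \<pi>l len_v by (simp add: v_def)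
      then show "length (w mon ! l) = length (v ! \<pi> l)"
        using w_nth_len[OF mon] l len by simp
      fix j assume "j < length (w mon ! l)"
      then have j: "j < d"
        using w_nth_len[OF mon] l len by simp
      have "\<alpha> l \<in> fib (w mon ! l)"
        using \<alpha>Q l len by (auto simp: Q_def)
      then show "w mon ! l ! j = v ! \<pi> l ! j"
        using j rep by (simp add: fib_def)
    qed
    have mset_nth: "mset xs = image_mset ((!) xs) (mset_set {..<length xs})" for xs :: "nat list list"
    proof -
      have "mset xs = mset (map ((!) xs) [0..<length xs])"
        by (simp only: map_nth)
      then show ?thesis
        by (simp only: mset_map mset_upt atLeast0LessThan)
    qed
    have "mset (w mon) = image_mset (\<lambda>l. v ! \<pi> l) (mset_set {..<m})"
      unfolding mset_nth[of "w mon"] len by (intro image_mset_cong) (simp add: nth)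
    also have "\<dots> = image_mset ((!) v) (image_mset \<pi> (mset_set {..<m}))"
      by (simp add: multiset.map_comp comp_def)
    also have "\<dots> = mset v"
      unfolding mset_nth[of v] by (simp add: image_mset_mset_set[OF \<pi>_inj] \<pi>_im len_v)
    finally have "mset (w mon) = mset (w mon0)"
      by (simp add: v_def)
    then show ?thesis
      by (intro poly_mapping_eqI) (simp flip: w_count)
  qed
  \<comment> \<open>The identity choice shows that the count for \<open>mon0\<close> is positive;
    being a complex number, it does not vanish.\<close>
  have "(\<lambda>l\<in>{..<m}. replicate d l) \<in> N mon0 M0"
    using len_v by (auto simp: N_def Q_def M0_def v_def[symmetric] fib_def tdom_def)
  then have "N mon0 M0 \<noteq> {}"
    by blast
  moreover have "finite (N mon0 M0)"
    using finQ by (simp add: N_def)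
  ultimately have "card (N mon0 M0) \<noteq> 0"
    by simp
  moreover have "c M0 = ?cf mon0 * of_nat (card (N mon0 M0))"
  proof -
    have "N mon M0 = {}" if "mon \<in> ?K" "mon \<noteq> mon0" for mon
      using only that by blast
    then show ?thesis
      unfolding c_def by (subst sum.remove[OF finK mon0(1)]) simp
  qed
  ultimately have "c M0 \<noteq> 0"
    using mon0(1) by (simp add: in_keys_iff)
  then show ?thesis
    using M0 van_c by blast
qed

section \<open>Change of the field\<close>

text \<open>A nonzero \<open>z\<close> is independent over the rationals, so the assignment of 1 to
  \<open>z\<close> extends to a rational linear map on all complex numbers.\<close>

lemma complex_rat_functional:
  assumes "(z :: complex) \<noteq> 0"
  obtains L :: "complex \<Rightarrow> rat" where "L 0 = 0" "\<And>x y. L (x + y) = L x + L y"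
    "\<And>q x. L (of_rat q * x) = q * L x" "L z = 1"
proof -
  interpret vector_space_pair "\<lambda>(q :: rat) (x :: complex). of_rat q * x" "\<lambda>(q :: rat) x. q * x"
    by unfold_locales (simp_all add: algebra_simps of_rat_add of_rat_mult)
  have "vs1.independent {z}"
    using assms by simp
  then obtain g where g: "Vector_Spaces.linear (\<lambda>q x. of_rat q * x) (\<lambda>q x. q * x) g" "g z = 1"
    using linear_independent_extend[of "{z}" "\<lambda>_. 1"] by auto
  interpret g: Vector_Spaces.linear "\<lambda>(q :: rat) (x :: complex). of_rat q * x" "\<lambda>(q :: rat) x. q * x" g
    by fact
  show ?thesis
    using that[of g] g(2) g.add g.scale g.zero by blast
qed

text \<open>A rational functional with value 1 at \<open>c x0\<close>, applied to every coefficient,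
  preserves all relations with integer coefficients at once, however many there are. Clearing
  denominators then gives integers.\<close>

lemma complex_kernel_imp_int_kernel:
  fixes c :: "'x \<Rightarrow> complex" and R :: "('x \<Rightarrow> int) set"
  assumes fin: "finite X" and x0: "x0 \<in> X" "c x0 \<noteq> 0"
    and ker: "\<And>N. N \<in> R \<Longrightarrow> (\<Sum>x\<in>X. c x * of_int (N x)) = 0"
  shows "\<exists>z :: 'x \<Rightarrow> int. (\<exists>x\<in>X. z x \<noteq> 0) \<and> (\<forall>N\<in>R. (\<Sum>x\<in>X. z x * N x) = 0)"
proof -
  obtain L :: "complex \<Rightarrow> rat" where L: "L 0 = 0" "\<And>x y. L (x + y) = L x + L y"
    "\<And>q x. L (of_rat q * x) = q * L x" "L (c x0) = 1"
    using complex_rat_functional[OF x0(2)] by blast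
  define q where "q x = L (c x)" for x
  have L_sum: "L (\<Sum>x\<in>Y. h x) = (\<Sum>x\<in>Y. L (h x))" for Y :: "'x set" and h
    by (induction Y rule: infinite_finite_induct) (auto simp: L)
  have q_ker: "(\<Sum>x\<in>X. q x * of_int (N x)) = 0" if "N \<in> R" for N
  proof -
    have "L (c x * of_int (N x)) = q x * of_int (N x)" for x
      using L(3)[of "of_int (N x)" "c x"] by (simp add: q_def mult.commute)
    then show ?thesis
      using arg_cong[OF ker[OF that], of L] by (simp add: L_sum L)
  qed
  define D where "D = (\<Prod>x\<in>X. snd (quotient_of (q x)))"
  have D: "D > 0"
    unfolding D_def by (intro prod_pos) (simp add: quotient_of_denom_pos')
  define z where "z x = fst (quotient_of (q x)) * (\<Prod>y\<in>X - {x}. snd (quotient_of (q y)))" for x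
  have z: "of_int (z x) = of_int D * q x" if "x \<in> X" for x
  proof -
    have "q x * of_int (snd (quotient_of (q x))) = of_int (fst (quotient_of (q x)))"
      using quotient_of_div[of "q x"] quotient_of_denom_pos'[of "q x"]
      by (cases "quotient_of (q x)") simp
    moreover have "D = snd (quotient_of (q x)) * (\<Prod>y\<in>X - {x}. snd (quotient_of (q y)))"
      unfolding D_def by (rule prod.remove[OF fin that])
    ultimately show ?thesis
      by (simp add: z_def mult_ac)
  qed
  have "(\<Sum>x\<in>X. z x * N x) = 0" if "N \<in> R" for N
  proof -
    have "(of_int (\<Sum>x\<in>X. z x * N x) :: rat) = of_int D * (\<Sum>x\<in>X. q x * of_int (N x))"
      by (simp add: z sum_distrib_left mult.assoc)
    then have "(of_int (\<Sum>x\<in>X. z x * N x) :: rat) = 0"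
      using q_ker[OF that] by simp
    then show ?thesis by (simp only: of_int_eq_0_iff)
  qed
  moreover have "z x0 \<noteq> 0"
  proof -
    have "(of_int (z x0) :: rat) = of_int D"
      using z[OF x0(1)] L(4) by (simp add: q_def)
    then show ?thesis using D by simp
  qed
  ultimately show ?thesis
    using x0(1) by blast
qed

text \<open>Reducing an integer kernel vector of minimal size keeps it nonzero: otherwise the
  characteristic divides all its entries and can be divided out.\<close>

lemma int_kernel_imp_field_kernel:
  fixes z :: "'x \<Rightarrow> int" and R :: "('x \<Rightarrow> int) set"
  assumes fin: "finite X" and nz: "\<exists>x\<in>X. z x \<noteq> 0"
    and ker: "\<And>N. N \<in> R \<Longrightarrow> (\<Sum>x\<in>X. z x * N x) = 0"
  shows "\<exists>c :: 'x \<Rightarrow> 'a::field. (\<exists>x\<in>X. c x \<noteq> 0) \<and> (\<forall>N\<in>R. (\<Sum>x\<in>X. c x * of_int (N x)) = 0)"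
  using nz ker
proof (induction "\<Sum>x\<in>X. nat \<bar>z x\<bar>" arbitrary: z rule: less_induct)
  case less
  show ?case
  proof (cases "\<exists>x\<in>X. (of_int (z x) :: 'a) \<noteq> 0")
    case True
    moreover have "(\<Sum>x\<in>X. of_int (z x) * (of_int (N x) :: 'a)) = 0" if "N \<in> R" for N
      using arg_cong[OF less.prems(2)[OF that], of "of_int :: int \<Rightarrow> 'a"] by simp
    ultimately show ?thesis
      by (intro exI[of _ "\<lambda>x. of_int (z x)"]) blast
  next
    case False
    define p where "p = int CHAR('a)"
    have "p dvd z x" if "x \<in> X" for x
      using False that by (auto simp: of_int_eq_0_iff_char_dvd p_def)
    then have "\<forall>x\<in>X. \<exists>w. z x = p * w"
      by (auto simp: dvd_def)
    then obtain w where w: "\<And>x. x \<in> X \<Longrightarrow> z x = p * w x"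
      by metis
    obtain x1 where x1: "x1 \<in> X" "z x1 \<noteq> 0"
      using less.prems(1) by blast
    \<comment> \<open>Characteristic 0 is excluded because \<open>z\<close> would have to vanish.
      Hence \<open>p \<ge> 2\<close>, and dividing by \<open>p\<close> at least halves all absolute
      values.\<close>
    have "CHAR('a) \<noteq> 1" "p \<noteq> 0"
      using w[OF x1(1)] x1(2) by auto
    then have p: "p \<ge> 2"
      unfolding p_def by (cases "CHAR('a)") auto
    \<comment> \<open>The extra 1 at the nonzero entry \<open>x1\<close> makes the decrease of the
      total size strict.\<close>
    have le: "nat \<bar>w x\<bar> + (if x = x1 then 1 else 0) \<le> nat \<bar>z x\<bar>" if "x \<in> X" for x
    proof -
      have "2 * \<bar>w x\<bar> \<le> p * \<bar>w x\<bar>"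
        using p by (intro mult_right_mono) auto
      then have "2 * \<bar>w x\<bar> \<le> \<bar>z x\<bar>"
        using w[OF that] p by (simp add: abs_mult)
      moreover have "w x1 \<noteq> 0"
        using w[OF x1(1)] x1(2) by auto
      ultimately show ?thesis by auto
    qed
    have "(\<Sum>x\<in>X. nat \<bar>w x\<bar>) + 1 = (\<Sum>x\<in>X. nat \<bar>w x\<bar> + (if x = x1 then 1 else 0))"
      using fin x1(1) by (simp add: sum.distrib)
    also have "\<dots> \<le> (\<Sum>x\<in>X. nat \<bar>z x\<bar>)"
      by (intro sum_mono le)
    finally have "(\<Sum>x\<in>X. nat \<bar>w x\<bar>) < (\<Sum>x\<in>X. nat \<bar>z x\<bar>)"
      by simp
    moreover have "\<exists>x\<in>X. w x \<noteq> 0"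
      using w[OF x1(1)] x1 by auto
    moreover have "(\<Sum>x\<in>X. w x * N x) = 0" if "N \<in> R" for N
    proof -
      have "p * (\<Sum>x\<in>X. w x * N x) = (\<Sum>x\<in>X. z x * N x)"
        by (simp add: sum_distrib_left w mult.assoc)
      then show ?thesis
        using less.prems(2)[OF that] p by simp
    qed
    ultimately show ?thesis
      by (intro less.hyps[of w])
  qed
qed

section \<open>Multi-affine functions\<close>

definition affine_fun :: "('a::field \<Rightarrow> 'a) \<Rightarrow> bool" where
  "affine_fun f \<longleftrightarrow> (\<exists>a b. \<forall>x. f x = a + b * x)"

lemma affine_fun_const: "affine_fun (\<lambda>_. c)"
  unfolding affine_fun_def by (intro exI[of _ c] exI[of _ 0]) simp

lemma affine_fun_id: "affine_fun (\<lambda>x. x)"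
  unfolding affine_fun_def by (intro exI[of _ 0] exI[of _ 1]) simp

lemma affine_fun_upd: "affine_fun (\<lambda>x. (p(v := x)) w)"
  by (cases "w = v") (auto simp: affine_fun_const affine_fun_id)

lemma affine_fun_cmult:
  assumes "affine_fun f"
  shows "affine_fun (\<lambda>x. c * f x)"
proof -
  obtain a b where "\<And>x. f x = a + b * x"
    using assms unfolding affine_fun_def by blast
  then show ?thesis
    unfolding affine_fun_def by (intro exI[of _ "c * a"] exI[of _ "c * b"]) (simp add: algebra_simps)
qed

lemma affine_fun_add:
  assumes "affine_fun f" "affine_fun g"
  shows "affine_fun (\<lambda>x. f x + g x)"
proof -
  obtain a b a' b' where "\<And>x. f x = a + b * x" "\<And>x. g x = a' + b' * x"
    using assms unfolding affine_fun_def by metis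
  then show ?thesis
    unfolding affine_fun_def by (intro exI[of _ "a + a'"] exI[of _ "b + b'"]) (simp add: algebra_simps)
qed

lemma affine_fun_sum:
  assumes "\<And>i. i \<in> I \<Longrightarrow> affine_fun (f i)"
  shows "affine_fun (\<lambda>x. \<Sum>i\<in>I. f i x)"
  using assms by (induction I rule: infinite_finite_induct) (simp_all add: affine_fun_const affine_fun_add)

text \<open>Only the factor \<open>i0\<close> may vary, so no square of the variable arises. If
  \<open>i0\<close> lies outside \<open>I\<close>, the product is constant.\<close>

lemma affine_fun_prod:
  assumes "finite I" "\<And>i. i \<in> I \<Longrightarrow> affine_fun (f i)"
    and const: "\<And>i x. i \<in> I \<Longrightarrow> i \<noteq> i0 \<Longrightarrow> f i x = f i 0"
  shows "affine_fun (\<lambda>x. \<Prod>i\<in>I. f i x)"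
proof (cases "i0 \<in> I")
  case True
  have "(\<Prod>i\<in>I. f i x) = (\<Prod>i\<in>I - {i0}. f i 0) * f i0 x" for x
  proof -
    have "(\<Prod>i\<in>I - {i0}. f i x) = (\<Prod>i\<in>I - {i0}. f i 0)"
      by (intro prod.cong refl const) auto
    then show ?thesis
      using prod.remove[OF assms(1) True, of "\<lambda>i. f i x"] by (simp add: mult.commute)
  qed
  then show ?thesis
    using affine_fun_cmult[OF assms(2)[OF True]] by simp
next
  case False
  then have "(\<Prod>i\<in>I. f i x) = (\<Prod>i\<in>I. f i 0)" for x
    by (intro prod.cong refl const) auto
  then have "(\<lambda>x. \<Prod>i\<in>I. f i x) = (\<lambda>_. \<Prod>i\<in>I. f i 0)"
    by (rule ext)
  then show ?thesis
    using affine_fun_const by metis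
qed

text \<open>Reducing integer equations only gives vanishing at 0/1-valued parameters; multi-affinity extends it to all
  parameters, also over finite fields.\<close>

lemma multi_affine_zero:
  fixes \<Phi> :: "('v \<Rightarrow> 'a::field) \<Rightarrow> 'a"
  assumes "finite V"
    and aff: "\<And>v p. v \<in> V \<Longrightarrow> affine_fun (\<lambda>x. \<Phi> (p(v := x)))"
    and zero: "\<And>p. (\<And>v. p v \<in> {0, 1}) \<Longrightarrow> \<Phi> p = 0"
    and p: "\<And>v. v \<notin> V \<Longrightarrow> p v \<in> {0, 1}"
  shows "\<Phi> p = 0"
  using \<open>finite V\<close> aff p
proof (induction V arbitrary: p rule: finite_induct)
  case empty
  then show ?case using zero by blast
next
  case (insert v V)
  have *: "\<Phi> (p(v := y)) = 0" if "y \<in> {0, 1}" for y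
    using insert that by (intro insert.IH) auto
  obtain a b where ab: "\<And>x. \<Phi> (p(v := x)) = a + b * x"
    using insert.prems(1)[of v p] unfolding affine_fun_def by blast
  \<comment> \<open>The points 0 and 1 are distinct in every field, and two zeros determine an
    affine function.\<close>
  have "a = 0" "b = 0"
    using *[of 0] *[of 1] ab[of 0] ab[of 1] by auto
  then show ?case
    using ab[of "p v"] by simp
qed

section \<open>Tensors of bounded partition rank as a parametrised family\<close>

text \<open>The parameter \<open>(k, b, u)\<close> is the value at \<open>u\<close> of the first or
  second factor of summand \<open>k\<close>. Working over commutative rings lets the same family be
  evaluated over the integers and mapped to any field.\<close>

definition param_tensor :: "nat \<Rightarrow> nat \<Rightarrow> (nat \<Rightarrow> nat set) \<Rightarrow> (nat \<times> bool \<times> nat list \<Rightarrow> 'a::comm_ring_1) \<Rightarrow> nat list \<Rightarrow> 'a"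
  where "param_tensor d r A p e = (\<Sum>k<r. p (k, True, nths e (A k)) * p (k, False, nths e ({..<d} - A k)))"

lemma prk_le_on_param_tensor:
  assumes "\<And>k. k < r \<Longrightarrow> A k \<noteq> {} \<and> A k \<subset> {..<d}"
  shows "prk_le_on d X (param_tensor d r A p) r"
  unfolding prk_le_on_def
proof (intro exI conjI allI impI ballI)
  fix k assume "k < r"
  then show "prk_one_on d X (\<lambda>e. p (k, True, nths e (A k)) * p (k, False, nths e ({..<d} - A k)))"
    unfolding prk_one_on_def
    using assms[of k]
    by (intro exI[of _ "A k"] conjI exI[of _ "\<lambda>u. p (k, True, u)"] exI[of _ "\<lambda>u. p (k, False, u)"]) auto
qed (simp add: param_tensor_def)

lemma prk_le_on_paramE:
  fixes S :: "nat list \<Rightarrow> 'a::field"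
  assumes "prk_le_on d X S r"
  obtains A p where "\<And>k. k < r \<Longrightarrow> A k \<noteq> {} \<and> A k \<subset> {..<d}"
    "\<And>e. e \<in> tdom d X \<Longrightarrow> S e = param_tensor d r A p e"
proof -
  obtain ts where *: "(\<forall>k<r. prk_one_on d X (ts k)) \<and> (\<forall>is\<in>tdom d X. S is = (\<Sum>k<r. ts k is))"
    using assms unfolding prk_le_on_def ..
  note ts = conjunct1[OF *] conjunct2[OF *]
  have "\<forall>k. \<exists>q. k < r \<longrightarrow> fst q \<noteq> {} \<and> fst q \<subset> {..<d} \<and> (\<forall>is\<in>tdom d X. ts k is =
          fst (snd q) (nths is (fst q)) * snd (snd q) (nths is ({..<d} - fst q)))"
  proof (intro allI)
    fix k
    show "\<exists>q. k < r \<longrightarrow> fst q \<noteq> {} \<and> fst q \<subset> {..<d} \<and> (\<forall>is\<in>tdom d X. ts k is =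
          fst (snd q) (nths is (fst q)) * snd (snd q) (nths is ({..<d} - fst q)))"
    proof (cases "k < r")
      case True
      with ts(1) have "prk_one_on d X (ts k)"
        by simp
      then show ?thesis
        unfolding prk_one_on_def
      proof (elim exE conjE)
        fix A g h
        assume "A \<noteq> {}" "A \<subset> {..<d}" "\<forall>is\<in>tdom d X. ts k is = g (nths is A) * h (nths is ({..<d} - A))"
        then show ?thesis
          by (intro exI[of _ "(A, g, h)"]) simp
      qed
    qed simp
  qed
  from choice[OF this] obtain q where q: "\<forall>k. k < r \<longrightarrow> fst (q k) \<noteq> {} \<and> fst (q k) \<subset> {..<d} \<and>
      (\<forall>is\<in>tdom d X. ts k is =
          fst (snd (q k)) (nths is (fst (q k))) * snd (snd (q k)) (nths is ({..<d} - fst (q k))))" ..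
  let ?p = "\<lambda>(k, b, u). (if b then fst (snd (q k)) else snd (snd (q k))) u"
  show ?thesis
  proof (rule that[of "\<lambda>k. fst (q k)" ?p])
    show "fst (q k) \<noteq> {} \<and> fst (q k) \<subset> {..<d}" if "k < r" for k
      using q that by blast
    fix e assume e: "e \<in> tdom d X"
    have "ts k e = ?p (k, True, nths e (fst (q k))) * ?p (k, False, nths e ({..<d} - fst (q k)))"
      if "k < r" for k
      unfolding prod.case if_True if_False using q that e by blast
    then show "S e = param_tensor d r (\<lambda>k. fst (q k)) ?p e"
      unfolding param_tensor_def ts(2)[rule_format, OF e] by (intro sum.cong) simp_all
  qed
qed

text \<open>Vanishing at integer parameters is a system of integer linear equations for the
  coefficients, which passes from the complex numbers to the target field. There it yields vanishing
  at 0/1-valued parameters, and \<open>multi_affine_zero\<close> gives the rest.\<close>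

lemma mform_transfer:
  fixes c :: "nat list set \<Rightarrow> complex"
  assumes c: "M0 \<in> matchings d m" "c M0 \<noteq> 0"
    and van: "\<And>S. prk_le_on d (\<lambda>_. {..<m}) S r \<Longrightarrow> mform d m c S = 0"
  obtains c' :: "nat list set \<Rightarrow> 'a::field" where "\<exists>M\<in>matchings d m. c' M \<noteq> 0"
    "\<And>S. prk_le_on d (\<lambda>_. {..<m}) S r \<Longrightarrow> mform d m c' S = 0"
proof -
  define R where "R = {\<lambda>M. \<Prod>e\<in>M. param_tensor d r A p e | A (p :: nat \<times> bool \<times> nat list \<Rightarrow> int).
    (\<forall>k<r. A k \<noteq> {} \<and> A k \<subset> {..<d})}"
  have of_int_param: "of_int (param_tensor d r A p e) = param_tensor d r A (\<lambda>v. of_int (p v)) e" for A p e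
    by (simp add: param_tensor_def)
  have "(\<Sum>M\<in>matchings d m. c M * of_int (N M)) = 0" if "N \<in> R" for N
  proof -
    from that obtain A and p :: "nat \<times> bool \<times> nat list \<Rightarrow> int"
      where N: "N = (\<lambda>M. \<Prod>e\<in>M. param_tensor d r A p e)" "\<forall>k<r. A k \<noteq> {} \<and> A k \<subset> {..<d}"
      unfolding R_def by blast
    show ?thesis
      using van[OF prk_le_on_param_tensor[where p = "\<lambda>v. of_int (p v)" and A = A]] N(2)
      by (simp add: N(1) mform_def of_int_param)
  qed
  then obtain z where z: "\<exists>M\<in>matchings d m. z M \<noteq> 0" "\<forall>N\<in>R. (\<Sum>M\<in>matchings d m. z M * N M) = 0"
    using complex_kernel_imp_int_kernel[where X = "matchings d m" and R = R and c = c, OF finite_matchings c]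
    by blast
  obtain c' :: "nat list set \<Rightarrow> 'a" where c': "\<exists>M\<in>matchings d m. c' M \<noteq> 0"
    "\<And>N. N \<in> R \<Longrightarrow> (\<Sum>M\<in>matchings d m. c' M * of_int (N M)) = 0"
    using int_kernel_imp_field_kernel[OF finite_matchings z(1) z(2)[rule_format]] by blast
  show ?thesis
  proof (rule that[OF c'(1)])
    fix S :: "nat list \<Rightarrow> 'a" assume "prk_le_on d (\<lambda>_. {..<m}) S r"
    then obtain A p where A: "\<And>k. k < r \<Longrightarrow> A k \<noteq> {} \<and> A k \<subset> {..<d}"
      and S: "\<And>e. e \<in> tdom d (\<lambda>_. {..<m}) \<Longrightarrow> S e = param_tensor d r A p e"
      by (rule prk_le_on_paramE) blast
    define B where "B k b = (if b then A k else {..<d} - A k)" for k b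
    \<comment> \<open>The finitely many parameters that entries of the box can involve. All others
      are set to 0 in \<open>p'\<close>, so that \<open>multi_affine_zero\<close> applies.\<close>
    define V where "V = (\<lambda>(k, b, e). (k, b, nths e (B k b))) ` ({..<r} \<times> UNIV \<times> tdom d (\<lambda>_. {..<m}))"
    have finV: "finite V"
      unfolding V_def by (intro finite_imageI finite_cartesian_product) (auto intro: finite_tdom)
    define \<Phi> where "\<Phi> p = mform d m c' (param_tensor d r A p)" for p
    define p' where "p' v = (if v \<in> V then p v else 0)" for v
    have "mform d m c' S = \<Phi> p'"
      unfolding \<Phi>_def
    proof (rule mform_cong)
      fix e assume e: "e \<in> tdom d (\<lambda>_. {..<m})"
      have "(k, b, nths e (B k b)) \<in> V" if "k < r" for k b
        using that e unfolding V_def by force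
      from this[of _ True] this[of _ False] show "S e = param_tensor d r A p' e"
        by (simp add: S[OF e] param_tensor_def p'_def B_def)
    qed
    also have "\<Phi> p' = 0"
    proof (rule multi_affine_zero[where \<Phi> = \<Phi> and p = p', OF finV])
      show "p' v \<in> {0, 1}" if "v \<notin> V" for v
        using that by (simp add: p'_def)
    next
      fix p :: "nat \<times> bool \<times> nat list \<Rightarrow> 'a" assume p: "\<And>v. p v \<in> {0, 1}"
      \<comment> \<open>A 0/1-valued parameter vector lifts to the integers, so its equation is one
        of those in \<open>R\<close>.\<close>
      define pz where "pz v = (if p v = 0 then 0 else 1 :: int)" for v
      have pz: "p = (\<lambda>v. of_int (pz v))"
        using p by (auto simp: pz_def fun_eq_iff)
      have "(\<lambda>M. \<Prod>e\<in>M. param_tensor d r A pz e) \<in> R"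
        unfolding R_def using A by blast
      from c'(2)[OF this] show "\<Phi> p = 0"
        by (simp add: \<Phi>_def mform_def pz of_int_param)
    next
      fix v :: "nat \<times> bool \<times> nat list" and p :: "nat \<times> bool \<times> nat list \<Rightarrow> 'a"
      assume "v \<in> V"
      then obtain k0 b0 u where v: "v = (k0, b0, u)" "k0 < r"
        unfolding V_def by auto
      have "\<exists>j0<d. j0 \<in> B k0 b0"
        using A[OF v(2)] by (cases b0) (auto simp: B_def)
      then obtain j0 where j0: "j0 \<in> B k0 b0" "j0 < d"
        by blast
      \<comment> \<open>The two factors of a summand carry different tags, so at most one of them
        involves the parameter \<open>v\<close>.\<close>
      have aff: "affine_fun (\<lambda>x. param_tensor d r A (p(v := x)) e)" for e
        unfolding param_tensor_def
      proof (rule affine_fun_sum)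
        fix k
        let ?a = "(k, True, nths e (A k))" and ?b = "(k, False, nths e ({..<d} - A k))"
        have "(\<lambda>x. (p(v := x)) ?a * (p(v := x)) ?b) =
            (if b0 then (\<lambda>x. p ?b * (p(v := x)) ?a) else (\<lambda>x. p ?a * (p(v := x)) ?b))"
          by (rule ext) (simp add: v)
        moreover have "affine_fun \<dots>"
          using affine_fun_cmult[OF affine_fun_upd[of p v]] by (cases b0) simp_all
        ultimately show "affine_fun (\<lambda>x. (p(v := x)) ?a * (p(v := x)) ?b)"
          by (simp only:)
      qed
      show "affine_fun (\<lambda>x. \<Phi> (p(v := x)))"
        unfolding \<Phi>_def mform_def
      proof (intro affine_fun_sum affine_fun_cmult)
        fix M assume M: "M \<in> matchings d m"
        have const: "param_tensor d r A (p(v := x)) e = param_tensor d r A (p(v := 0)) e"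
          if "nths e (B k0 b0) \<noteq> u" for e x
          using that unfolding param_tensor_def by (intro sum.cong) (auto simp: v B_def split: if_splits)
        \<comment> \<open>Edges of a matching differ in every coordinate, in particular in
          \<open>j0\<close>. Hence at most one edge restricts to \<open>u\<close>, and at most one
          factor of the product involves \<open>v\<close>.\<close>
        obtain e0 where e0: "\<And>e. e \<in> M \<Longrightarrow> nths e (B k0 b0) = u \<Longrightarrow> e = e0"
        proof (cases "\<exists>e\<in>M. nths e (B k0 b0) = u")
          case True
          then obtain e0 where e0: "e0 \<in> M" "nths e0 (B k0 b0) = u" by blast
          show ?thesis
          proof (rule that)
            fix e assume e: "e \<in> M" "nths e (B k0 b0) = u"
            have len: "length e = d" "length e0 = d"
              using matchings_subset[OF M] e(1) e0(1) by (auto intro: tdom_length)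
            have "nths e (B k0 b0) = nths e0 (B k0 b0)"
              using e(2) e0(2) by simp
            then have "e ! j0 = e0 ! j0"
              using nths_eq_iff[of e e0 "B k0 b0"] len j0 by simp
            then show "e = e0"
              using matchings_inj[OF M e(1) e0(1) j0(2)] by blast
          qed
        qed (use that in blast)
        show "affine_fun (\<lambda>x. \<Prod>e\<in>M. param_tensor d r A (p(v := x)) e)"
          using const e0 by (intro affine_fun_prod[OF finite_matching[OF M] aff, of e0]) blast
      qed
    qed
    finally show "mform d m c' S = 0" .
  qed
qed

section \<open>The bound\<close>

text \<open>Choose the \<open>s\<close> coordinates of agreement; each of the other
  \<open>d - s\<close> coordinates avoids the value of \<open>e\<close> and has \<open>m - 1\<close>
  possibilities.\<close>

lemma card_agree_le:
  assumes e: "e \<in> tdom d (\<lambda>_. {..<m})"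
  defines "J \<equiv> \<lambda>e'. {j. j < d \<and> e' ! j = e ! j}"
  shows "card {e' \<in> tdom d (\<lambda>_. {..<m}). J e' \<noteq> {} \<and> card (J e') \<le> d div 2}
    \<le> (\<Sum>s=1..d div 2. (d choose s) * (m - 1) ^ (d - s))"
proof -
  let ?D = "tdom d (\<lambda>_. {..<m})"
  let ?JJ = "\<lambda>s. {B. B \<subseteq> {..<d} \<and> card B = s}"
  have sub: "{e' \<in> ?D. J e' \<noteq> {} \<and> card (J e') \<le> d div 2}
      \<subseteq> (\<Union>s\<in>{1..d div 2}. \<Union>B\<in>?JJ s. {e' \<in> ?D. J e' = B})"
  proof
    fix e' assume e': "e' \<in> {e' \<in> ?D. J e' \<noteq> {} \<and> card (J e') \<le> d div 2}"
    then have "card (J e') > 0"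
      by (simp add: card_gt_0_iff J_def)
    with e' have "card (J e') \<in> {1..d div 2}" "J e' \<in> ?JJ (card (J e'))" "e' \<in> {e'' \<in> ?D. J e'' = J e'}"
      by (auto simp: J_def)
    then show "e' \<in> (\<Union>s\<in>{1..d div 2}. \<Union>B\<in>?JJ s. {e' \<in> ?D. J e' = B})"
      by blast
  qed
  have one: "card {e' \<in> ?D. J e' = B} \<le> (m - 1) ^ (d - s)" if "B \<in> ?JJ s" for B s
  proof -
    have em: "e ! j < m" if "j < d" for j
      using tdom_nth[OF e that] by simp
    let ?Z = "\<lambda>j. if j \<in> B then {e ! j} else {..<m} - {e ! j}"
    have "{e' \<in> ?D. J e' = B} \<subseteq> tdom d ?Z"
      by (auto simp: tdom_def J_def)
    then have "card {e' \<in> ?D. J e' = B} \<le> card (tdom d ?Z)"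
      by (intro card_mono finite_tdom) auto
    also have "\<dots> \<le> (\<Prod>j<d. card (?Z j))"
      by (intro card_tdom_le) auto
    also have "\<dots> = (\<Prod>j<d. if j \<in> B then 1 else m - 1)"
      using em by (intro prod.cong) auto
    also have "\<dots> = (m - 1) ^ card ({..<d} - B)"
      by (simp add: prod.If_cases Diff_eq)
    also have "card ({..<d} - B) = d - s"
      using that by (subst card_Diff_subset) (auto intro: finite_subset)
    finally show ?thesis .
  qed
  have fin: "finite {e' \<in> ?D. Q e'}" for Q
    by (rule finite_subset[of _ ?D]) (auto intro: finite_tdom)
  have finJJ: "finite (?JJ s)" for s
    by (rule finite_subset[of _ "Pow {..<d}"]) auto
  have "card {e' \<in> ?D. J e' \<noteq> {} \<and> card (J e') \<le> d div 2}
      \<le> card (\<Union>s\<in>{1..d div 2}. \<Union>B\<in>?JJ s. {e' \<in> ?D. J e' = B})"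
    by (intro card_mono sub finite_UN_I finJJ fin) auto
  also have "\<dots> \<le> (\<Sum>s=1..d div 2. card (\<Union>B\<in>?JJ s. {e' \<in> ?D. J e' = B}))"
    by (intro card_UN_le) auto
  also have "\<dots> \<le> (\<Sum>s=1..d div 2. \<Sum>B\<in>?JJ s. card {e' \<in> ?D. J e' = B})"
    by (intro sum_mono card_UN_le finJJ)
  also have "\<dots> \<le> (\<Sum>s=1..d div 2. \<Sum>B\<in>?JJ s. (m - 1) ^ (d - s))"
    by (intro sum_mono one)
  also have "\<dots> = (\<Sum>s=1..d div 2. (d choose s) * (m - 1) ^ (d - s))"
    by (simp add: n_subsets)
  finally show ?thesis .
qed

text \<open>Take the edge \<open>e1\<close> of \<open>M\<close> that meets \<open>e\<close> in
  coordinate 0 and the edge \<open>e2\<close> that meets \<open>e\<close> where \<open>e1\<close>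
  does not. Distinct edges of a matching share no coordinate value, so the two sets of agreement are
  disjoint and one has at most \<open>d div 2\<close> elements.\<close>

lemma matching_agree_le_half:
  assumes M: "M \<in> matchings d m" and d: "d \<ge> 2" and e: "e \<in> tdom d (\<lambda>_. {..<m})" "e \<notin> M"
  obtains e' where "e' \<in> M" "{j. j < d \<and> e' ! j = e ! j} \<noteq> {}"
    "card {j. j < d \<and> e' ! j = e ! j} \<le> d div 2"
proof -
  define J where "J e' = {j. j < d \<and> e' ! j = e ! j}" for e'
  have ex: "\<exists>e'\<in>M. j \<in> J e'" if "j < d" for j
    using matchings_surj[OF M that, of "e ! j"] tdom_nth[OF e(1) that] that by (auto simp: J_def)
  obtain e1 where e1: "e1 \<in> M" "0 \<in> J e1"
    using ex[of 0] d by auto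
  have "e1 \<noteq> e" using e(2) e1(1) by blast
  then obtain j where j: "j < d" "j \<notin> J e1"
    using tdom_eqI[OF matchings_subset[OF M e1(1)] e(1)] by (auto simp: J_def)
  obtain e2 where e2: "e2 \<in> M" "j \<in> J e2"
    using ex[OF j(1)] by blast
  have "J e1 \<inter> J e2 = {}"
  proof (rule ccontr)
    assume "J e1 \<inter> J e2 \<noteq> {}"
    then obtain i where "i \<in> J e1" "i \<in> J e2"
      by blast
    then have "i < d" "e1 ! i = e2 ! i"
      by (simp_all add: J_def)
    then have "e1 = e2"
      using matchings_inj[OF M e1(1) e2(1)] by blast
    with j e2 show False by blast
  qed
  then have "card (J e1) + card (J e2) = card (J e1 \<union> J e2)"
    by (simp add: card_Un_disjoint J_def)
  also have "\<dots> \<le> card {..<d}"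
    by (intro card_mono) (auto simp: J_def)
  finally have "card (J e1) \<le> d div 2 \<or> card (J e2) \<le> d div 2"
    by auto
  then show ?thesis
    using that[of e1] that[of e2] e1 e2 unfolding J_def by blast
qed

section \<open>Stripping variables off the form\<close>

text \<open>The injections \<open>\<phi>\<close> describe the
  \<open>m \<times> ... \<times> m\<close> subtensors with a numbering of their sides. An identity
  that is linear in one entry is solved for that entry, off few slices.\<close>

lemma prk_le_of_mform_vanishing:
  fixes c :: "nat list set \<Rightarrow> 'a::field" and T :: "nat list \<Rightarrow> 'a"
  assumes d: "d \<ge> 2" and M0: "M0 \<in> matchings d m" "c M0 \<noteq> 0"
    and van: "\<And>\<phi>. (\<And>j. j < d \<Longrightarrow> inj_on (\<phi> j) {..<m} \<and> \<phi> j ` {..<m} \<subseteq> X j)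
                 \<Longrightarrow> mform d m c (\<lambda>is. T (pull d \<phi> is)) = 0"
  shows "prk_le_on d X T (d * (m - 1) + (\<Sum>s=1..d div 2. (d choose s) * (m - 1) ^ (d - s)))"
proof -
  \<comment> \<open>\<open>F E\<close> is the coefficient of the monomial \<open>E\<close> in the
    form, evaluated on a pulled back tensor. It only involves the coordinate values
    \<open>U E j\<close> left free by \<open>E\<close>, so \<open>good\<close> constrains
    \<open>\<phi>\<close> on these alone.\<close>
  define U where "U E j = {..<m} - (\<lambda>e. e ! j) ` E" for E :: "nat list set" and j
  define F where "F E \<phi> = (\<Sum>M | M \<in> matchings d m \<and> E \<subseteq> M. c M * (\<Prod>e\<in>M - E. T (pull d \<phi> e)))" for E \<phi>
  define good where "good E \<longleftrightarrow>
    (\<forall>\<phi>. (\<forall>j<d. inj_on (\<phi> j) (U E j) \<and> \<phi> j ` U E j \<subseteq> X j) \<longrightarrow> F E \<phi> = 0)" for E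
  have finM0: "finite M0"
    using finite_matching[OF M0(1)] .
  have "good {}"
    using van by (auto simp: good_def F_def U_def mform_def)
  have bad: "\<not> good M0"
  proof -
    have eq: "M = M0" if "M \<in> matchings d m" "M0 \<subseteq> M" for M
    proof -
      have "M \<subseteq> M0"
      proof
        fix e assume "e \<in> M"
        then have "e ! 0 < m"
          using tdom_nth[OF matchings_subset[OF that(1)], of e 0] d by simp
        then obtain e' where "e' \<in> M0" "e' ! 0 = e ! 0"
          using matchings_surj[OF M0(1), of 0] d by auto
        then have "e = e'"
          using matchings_inj[OF that(1) \<open>e \<in> M\<close>, of e' 0] that(2) d by auto
        then show "e \<in> M0" using \<open>e' \<in> M0\<close> by simp
      qed
      then show ?thesis using that(2) by blast
    qed
    have "{M. M \<in> matchings d m \<and> M0 \<subseteq> M} = {M0}"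
      using eq M0(1) by blast
    then have "F M0 \<phi> = c M0" for \<phi>
      by (simp add: F_def)
    moreover have "U M0 j = {}" if "j < d" for j
      using M0(1) that by (auto simp: U_def matchings_def bij_betw_def)
    ultimately show ?thesis
      using M0(2) by (auto simp: good_def)
  qed
  \<comment> \<open>Adding the edges of \<open>M0\<close> one at a time leads from the good empty
    set to the bad \<open>M0\<close>, so goodness is lost at some step.\<close>
  have "\<exists>E e. E \<subseteq> M0 \<and> e \<in> M0 - E \<and> good E \<and> \<not> good (insert e E)"
  proof (rule ccontr)
    assume contra: "\<not> ?thesis"
    have "E \<subseteq> M0 \<Longrightarrow> good E" if "finite E" for E
      using that
    proof (induction E rule: finite_induct)
      case (insert e E)
      then show ?case using contra by blast
    qed (use \<open>good {}\<close> in simp)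
    then show False using bad finM0 by blast
  qed
  then obtain E e where E: "E \<subseteq> M0" "e \<in> M0" "e \<notin> E" "good E" "\<not> good (insert e E)"
    by blast
  obtain \<phi> where \<phi>: "\<And>j. j < d \<Longrightarrow> inj_on (\<phi> j) (U (insert e E) j) \<and> \<phi> j ` U (insert e E) j \<subseteq> X j"
    and D: "F (insert e E) \<phi> \<noteq> 0"
    using E(5) unfolding good_def by blast
  have eD: "e \<in> tdom d (\<lambda>_. {..<m})"
    using matchings_subset[OF M0(1) E(2)] .
  have em: "e ! j < m" if "j < d" for j
    using tdom_nth[OF eD that] by simp
  have eE: "e ! j \<notin> (\<lambda>e. e ! j) ` E" if "j < d" for j
    using matchings_inj[OF M0(1) E(2) _ that] E(1,3) by blast
  have U_insert: "U E j = insert (e ! j) (U (insert e E) j)" "e ! j \<notin> U (insert e E) j" if "j < d" for j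
    using em[OF that] eE[OF that] by (auto simp: U_def)
  define Y where "Y j = \<phi> j ` U (insert e E) j" for j
  have cardY: "card (Y j) \<le> m - 1" if "j < d" for j
  proof -
    have "card (Y j) \<le> card (U (insert e E) j)"
      unfolding Y_def by (rule card_image_le) (simp add: U_def)
    also have "\<dots> \<le> card ({..<m} - {e ! j})"
      by (intro card_mono) (auto simp: U_def)
    also have "\<dots> = m - 1"
      using em[OF that] by simp
    finally show ?thesis .
  qed
  \<comment> \<open>The free value \<open>e ! j\<close> is sent to the varying index
    \<open>is ! j\<close>. This keeps injectivity as long as \<open>is ! j\<close> avoids
    \<open>Y j\<close>.\<close>
  define \<psi> where "\<psi> is j = (\<phi> j)(e ! j := is ! j)" for "is" :: "nat list" and j
  define Ms where "Ms = {M \<in> matchings d m. E \<subseteq> M \<and> e \<notin> M}"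
  have finMs: "finite Ms"
    unfolding Ms_def using finite_matchings by simp
  \<comment> \<open>In \<open>F E\<close> the matchings through \<open>e\<close> contribute the
    entry of \<open>T\<close> at \<open>is\<close> times a coefficient free of \<open>is\<close>,
    because their other edges avoid all coordinate values of \<open>e\<close>. The matchings missing
    \<open>e\<close> make up the right-hand side.\<close>
  have main: "T is * F (insert e E) \<phi> = - (\<Sum>M\<in>Ms. c M * (\<Prod>e'\<in>M - E. T (pull d (\<psi> is) e')))"
    if "is": "is \<in> tdom d X" and off: "\<And>j. j < d \<Longrightarrow> is ! j \<notin> Y j" for "is"
  proof -
    have "inj_on (\<psi> is j) (U E j) \<and> \<psi> is j ` U E j \<subseteq> X j" if "j < d" for j
    proof -
      have "inj_on (\<psi> is j) (U (insert e E) j)"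
        using \<phi>[OF that] U_insert(2)[OF that] by (auto simp: \<psi>_def inj_on_def)
      moreover have im: "\<psi> is j ` U (insert e E) j = Y j"
        using U_insert(2)[OF that] by (auto simp: \<psi>_def Y_def image_def)
      moreover have "\<psi> is j (e ! j) = is ! j"
        by (simp add: \<psi>_def)
      ultimately show ?thesis
        using off[OF that] \<phi>[OF that] tdom_nth[OF "is" that] U_insert(2)[OF that]
        unfolding U_insert(1)[OF that] by (auto simp: Y_def)
    qed
    then have "0 = F E (\<psi> is)"
      using E(4) unfolding good_def by auto
    also have "{M. M \<in> matchings d m \<and> E \<subseteq> M} = {M. M \<in> matchings d m \<and> insert e E \<subseteq> M} \<union> Ms"
      by (auto simp: Ms_def)
    then have "F E (\<psi> is) = (\<Sum>M | M \<in> matchings d m \<and> insert e E \<subseteq> M. c M * (\<Prod>e'\<in>M - E. T (pull d (\<psi> is) e')))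
        + (\<Sum>M\<in>Ms. c M * (\<Prod>e'\<in>M - E. T (pull d (\<psi> is) e')))"
      unfolding F_def using finite_matchings[of d m] finMs
      by (subst sum.union_disjoint[symmetric]) (auto simp: Ms_def)
    also have "(\<Sum>M | M \<in> matchings d m \<and> insert e E \<subseteq> M. c M * (\<Prod>e'\<in>M - E. T (pull d (\<psi> is) e')))
        = T is * F (insert e E) \<phi>"
      unfolding F_def sum_distrib_left
    proof (intro sum.cong refl)
      fix M assume "M \<in> {M. M \<in> matchings d m \<and> insert e E \<subseteq> M}"
      then have M: "M \<in> matchings d m" "insert e E \<subseteq> M" by auto
      have "e \<in> M - E" "M - E - {e} = M - insert e E"
        using M(2) E(3) by blast+
      then have "(\<Prod>e'\<in>M - E. T (pull d (\<psi> is) e'))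
          = T (pull d (\<psi> is) e) * (\<Prod>e'\<in>M - insert e E. T (pull d (\<psi> is) e'))"
        using prod.remove[of "M - E" e "\<lambda>e'. T (pull d (\<psi> is) e')"] finite_matching[OF M(1)] by simp
      also have "pull d (\<psi> is) e = is"
        using tdom_length[OF "is"] by (auto simp: \<psi>_def intro: nth_equalityI)
      also have "(\<Prod>e'\<in>M - insert e E. T (pull d (\<psi> is) e')) = (\<Prod>e'\<in>M - insert e E. T (pull d \<phi> e'))"
      proof (intro prod.cong refl)
        fix e' assume e': "e' \<in> M - insert e E"
        have "e' ! j \<noteq> e ! j" if "j < d" for j
          using matchings_inj[OF M(1) _ _ that, of e' e] e' M(2) by auto
        then have "pull d (\<psi> is) e' = pull d \<phi> e'"
          by (auto simp: \<psi>_def intro: nth_equalityI)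
        then show "T (pull d (\<psi> is) e') = T (pull d \<phi> e')" by simp
      qed
      finally show "c M * (\<Prod>e'\<in>M - E. T (pull d (\<psi> is) e'))
          = T is * (c M * (\<Prod>e'\<in>M - insert e E. T (pull d \<phi> e')))"
        by simp
    qed
    finally show ?thesis
      by (simp add: eq_neg_iff_add_eq_0)
  qed
  define J where "J e' = {j. j < d \<and> e' ! j = e ! j}" for e'
  have "\<exists>e'. e' \<in> M \<and> J e' \<noteq> {} \<and> card (J e') \<le> d div 2" if "M \<in> Ms" for M
    using matching_agree_le_half[of M d m e] d eD that unfolding J_def Ms_def by blast
  then obtain h where h: "\<And>M. M \<in> Ms \<Longrightarrow> h M \<in> M \<and> J (h M) \<noteq> {} \<and> card (J (h M)) \<le> d div 2"
    by metis
  \<comment> \<open>Edges of \<open>E\<close> share no coordinate value with \<open>e\<close>. So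
    \<open>h M\<close> is one of the factors left in the product and can be split off.\<close>
  have h_notin: "h M \<notin> E" if M: "M \<in> Ms" for M
  proof
    assume "h M \<in> E"
    moreover obtain j where "j < d" "h M ! j = e ! j"
      using h[OF M] by (auto simp: J_def)
    ultimately show False
      using eE[of j] imageI[of "h M" E "\<lambda>e. e ! j"] by simp
  qed
  define I where "I = {e' \<in> tdom d (\<lambda>_. {..<m}). J e' \<noteq> {} \<and> card (J e') \<le> d div 2}"
  have finI: "finite I"
    unfolding I_def by (rule finite_subset[of _ "tdom d (\<lambda>_. {..<m})"]) (auto intro: finite_tdom)
  have hI: "h ` Ms \<subseteq> I"
    using h matchings_subset unfolding I_def Ms_def by blast
  define off where "off is \<longleftrightarrow> (\<forall>j<d. is ! j \<notin> Y j)" for "is"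
  \<comment> \<open>\<open>G\<close> is the factor of the chosen edge \<open>e'\<close>, and
    \<open>H\<close> collects the cofactors from all matchings that chose it. Each is cut off on the
    slices it can see, so their product vanishes unless \<open>is\<close> avoids all
    \<open>Y j\<close>.\<close>
  define G where "G e' is = (if \<forall>j\<in>J e'. is ! j \<notin> Y j then T (pull d (\<psi> is) e') else 0)" for e' "is"
  define H where "H e' is = (if \<forall>j\<in>{..<d} - J e'. is ! j \<notin> Y j then - 1 / F (insert e E) \<phi> *
      (\<Sum>M | M \<in> Ms \<and> h M = e'. c M * (\<Prod>e''\<in>M - E - {e'}. T (pull d (\<psi> is) e''))) else 0)" for e' "is"
  have "prk_le_on d X (\<lambda>is. if off is then T is else 0) (\<Sum>s=1..d div 2. (d choose s) * (m - 1) ^ (d - s))"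
  proof (rule prk_le_onI[OF d finI, where t = "\<lambda>e' is. G e' is * H e' is"])
    show "card I \<le> (\<Sum>s=1..d div 2. (d choose s) * (m - 1) ^ (d - s))"
      unfolding I_def J_def by (rule card_agree_le[OF eD])
  next
    fix e' assume e': "e' \<in> I"
    show "prk_one_on d X (\<lambda>is. G e' is * H e' is)"
    proof (rule prk_one_onI[where A = "J e'" and G = "G e'" and H = "H e'"])
      show "J e' \<noteq> {}" using e' by (simp add: I_def)
      have "card (J e') \<le> d div 2"
        using e' by (simp add: I_def)
      then have "J e' \<noteq> {..<d}"
      proof (rule contrapos_pn)
        assume "J e' = {..<d}"
        then have "card (J e') = d"
          by (simp only: card_lessThan)
        then show "\<not> card (J e') \<le> d div 2"
          using d by linarith
      qed
      moreover have "J e' \<subseteq> {..<d}"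
        by (auto simp: J_def)
      ultimately show "J e' \<subset> {..<d}"
        by (simp only: psubset_eq simp_thms)
      show "depends_on d (J e') (G e')"
      proof (rule depends_onI)
        fix xs ys :: "nat list"
        assume *: "\<And>j. j < d \<Longrightarrow> j \<in> J e' \<Longrightarrow> xs ! j = ys ! j"
        then have "pull d (\<psi> xs) e' = pull d (\<psi> ys) e'"
          by (intro nth_equalityI) (auto simp: \<psi>_def J_def)
        moreover have "(\<forall>j\<in>J e'. xs ! j \<notin> Y j) \<longleftrightarrow> (\<forall>j\<in>J e'. ys ! j \<notin> Y j)"
          using * by (auto simp: J_def)
        ultimately show "G e' xs = G e' ys"
          unfolding G_def by (simp only:)
      qed
      show "depends_on d ({..<d} - J e') (H e')"
      proof (rule depends_onI)
        fix xs ys :: "nat list"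
        assume *: "\<And>j. j < d \<Longrightarrow> j \<in> {..<d} - J e' \<Longrightarrow> xs ! j = ys ! j"
        have "pull d (\<psi> xs) e'' = pull d (\<psi> ys) e''"
          if "M \<in> Ms" "h M = e'" "e'' \<in> M - E - {e'}" for M e''
        proof (intro nth_equalityI)
          fix j assume "j < length (pull d (\<psi> xs) e'')"
          then have j: "j < d" by simp
          \<comment> \<open>Another edge of the same matching cannot agree with \<open>e\<close>
            where \<open>e'\<close> does, so the cofactors read \<open>is\<close> only outside
            \<open>J e'\<close>.\<close>
          have "\<not> (e'' ! j = e ! j \<and> e' ! j = e ! j)"
            using matchings_inj[of M d m e'' e' j] that h[OF that(1)] j by (auto simp: Ms_def)
          then show "pull d (\<psi> xs) e'' ! j = pull d (\<psi> ys) e'' ! j"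
            using *[OF j] j by (auto simp: \<psi>_def J_def)
        qed simp
        then have "(\<Sum>M | M \<in> Ms \<and> h M = e'. c M * (\<Prod>e''\<in>M - E - {e'}. T (pull d (\<psi> xs) e'')))
          = (\<Sum>M | M \<in> Ms \<and> h M = e'. c M * (\<Prod>e''\<in>M - E - {e'}. T (pull d (\<psi> ys) e'')))"
          by (intro sum.cong refl arg_cong2[where f = "(*)"] prod.cong arg_cong[where f = T]) auto
        moreover have "(\<forall>j\<in>{..<d} - J e'. xs ! j \<notin> Y j) \<longleftrightarrow> (\<forall>j\<in>{..<d} - J e'. ys ! j \<notin> Y j)"
          using * by auto
        ultimately show "H e' xs = H e' ys"
          unfolding H_def by (simp only:)
      qed
    qed simp
  next
    fix "is" assume "is": "is \<in> tdom d X"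
    have zero: "G e' is * H e' is = 0" if "\<not> off is" for e'
      using that by (auto simp: off_def G_def H_def)
    show "(if off is then T is else 0) = (\<Sum>e'\<in>I. G e' is * H e' is)"
    proof (cases "off is")
      case True
      let ?P = "\<lambda>M. c M * (\<Prod>e'\<in>M - E. T (pull d (\<psi> is) e'))"
      have GH: "G e' is * H e' is = - 1 / F (insert e E) \<phi> * (\<Sum>M | M \<in> Ms \<and> h M = e'. ?P M)" for e'
      proof -
        have "T (pull d (\<psi> is) e') * (\<Prod>e''\<in>M - E - {e'}. T (pull d (\<psi> is) e''))
            = (\<Prod>e''\<in>M - E. T (pull d (\<psi> is) e''))" if "M \<in> Ms" "h M = e'" for M
        proof -
          have "finite (M - E)"
            using that(1) finite_matching unfolding Ms_def by blast
          moreover have "e' \<in> M - E"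
            using h[OF that(1)] h_notin[OF that(1)] that(2) by blast
          ultimately show ?thesis
            by (rule prod.remove[symmetric])
        qed
        then have "T (pull d (\<psi> is) e') * (\<Sum>M | M \<in> Ms \<and> h M = e'. c M * (\<Prod>e''\<in>M - E - {e'}. T (pull d (\<psi> is) e'')))
            = (\<Sum>M | M \<in> Ms \<and> h M = e'. ?P M)"
          unfolding sum_distrib_left by (intro sum.cong refl) (simp add: mult.left_commute)
        moreover have "\<forall>j\<in>J e'. is ! j \<notin> Y j" "\<forall>j\<in>{..<d} - J e'. is ! j \<notin> Y j"
          using True by (auto simp: off_def J_def)
        ultimately show ?thesis
          unfolding G_def H_def by (simp add: mult.left_commute)
      qed
      have "(\<Sum>e'\<in>I. G e' is * H e' is) = - 1 / F (insert e E) \<phi> * (\<Sum>e'\<in>I. \<Sum>M | M \<in> Ms \<and> h M = e'. ?P M)"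
        by (simp only: GH sum_distrib_left)
      also have "(\<Sum>e'\<in>I. \<Sum>M | M \<in> Ms \<and> h M = e'. ?P M) = (\<Sum>M\<in>Ms. ?P M)"
        by (rule sum.group[OF finMs finI hI])
      also have "- 1 / F (insert e E) \<phi> * (\<Sum>M\<in>Ms. ?P M) = T is"
        using main[OF "is"] True D by (simp add: off_def field_simps)
      finally show ?thesis using True by simp
    qed (simp add: zero)
  qed
  moreover have "prk_le_on d X (\<lambda>is. if \<exists>j<d. is ! j \<in> Y j then T is else 0) (d * (m - 1))"
  proof (rule prk_le_on_mono[OF d prk_le_on_slices[OF d]])
    show "finite (Y j)" for j
      by (simp add: Y_def U_def)
    have "(\<Sum>j<d. card (Y j)) \<le> (\<Sum>j<d. m - 1)"
      using cardY by (intro sum_mono) simp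
    then show "(\<Sum>j<d. card (Y j)) \<le> d * (m - 1)"
      by simp
  qed
  ultimately have "prk_le_on d X (\<lambda>is. (if \<exists>j<d. is ! j \<in> Y j then T is else 0) + (if off is then T is else 0))
      (d * (m - 1) + (\<Sum>s=1..d div 2. (d choose s) * (m - 1) ^ (d - s)))"
    by (intro prk_le_on_add[OF d])
  then show ?thesis
    by (subst prk_le_on_cong[where T = "\<lambda>is. (if \<exists>j<d. is ! j \<in> Y j then T is else 0) + (if off is then T is else 0)"])
      (auto simp: off_def)
qed

text \<open>All summands are distinct terms of the binomial expansion of
  \<open>(1 + (m - 1)) ^ d\<close>: the first is the term \<open>s = d - 1\<close>, which exceeds
  \<open>d div 2\<close> because \<open>d \<ge> 3\<close>.\<close>

lemma bound_le_power:
  fixes d m :: nat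
  assumes "d \<ge> 3" "m \<ge> 1"
  shows "d * (m - 1) + (\<Sum>s=1..d div 2. (d choose s) * (m - 1) ^ (d - s)) \<le> m ^ d"
proof -
  let ?t = "\<lambda>s. (d choose s) * (m - 1) ^ (d - s)"
  have "d choose (d - 1) = d"
    using binomial_symmetric[of 1 d] assms(1) by simp
  then have "d * (m - 1) = ?t (d - 1)"
    using assms(1) by simp
  moreover have "d - 1 \<notin> {1..d div 2}"
    using assms by auto
  ultimately have "d * (m - 1) + (\<Sum>s=1..d div 2. ?t s) = (\<Sum>s\<in>insert (d - 1) {1..d div 2}. ?t s)"
    by simp
  also have "\<dots> \<le> (\<Sum>s\<le>d. ?t s)"
    by (intro sum_mono2) auto
  also have "\<dots> = (1 + (m - 1)) ^ d"
    by (subst binomial) simp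
  also have "1 + (m - 1) = m"
    using assms by simp
  finally show ?thesis .
qed

theorem theorem2:
  fixes d r m :: nat and n :: "nat \<Rightarrow> nat" and T :: "nat list \<Rightarrow> 'a::field"
  assumes "d \<ge> 2" and "r \<ge> 1" and "m \<ge> 1"
    and "\<exists>(n0 :: nat \<Rightarrow> nat) (f :: cpoly).
           (\<forall>j<d. n0 j > 0) \<and> f \<noteq> 0 \<and> total_degree f = m \<and>
           poly_vars f \<subseteq> tdom d (\<lambda>j. {..<n0 j}) \<and>
           (\<forall>S :: nat list \<Rightarrow> complex. prk_le_on d (\<lambda>j. {..<n0 j}) S r \<longrightarrow> peval f S = 0)"
    and "\<forall>j<d. n j \<ge> m"
    and "\<forall>X :: nat \<Rightarrow> nat set. (\<forall>j<d. X j \<subseteq> {..<n j} \<and> card (X j) = m)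
           \<longrightarrow> prk_on d X T \<le> r"
  shows "prk_on d (\<lambda>j. {..<n j}) T
           \<le> d * (m - 1) + (\<Sum>s=1..d div 2. (d choose s) * (m - 1) ^ (d - s))
       \<and> (d \<ge> 3 \<longrightarrow> d * (m - 1) + (\<Sum>s=1..d div 2. (d choose s) * (m - 1) ^ (d - s)) \<le> m ^ d)"
proof (intro conjI impI)
  obtain n0 :: "nat \<Rightarrow> nat" and f :: cpoly where f: "f \<noteq> 0" "total_degree f = m"
      "poly_vars f \<subseteq> tdom d (\<lambda>j. {..<n0 j})"
    and f0: "\<And>S. prk_le_on d (\<lambda>j. {..<n0 j}) S r \<Longrightarrow> peval f S = 0"
    using assms(4) by blast
  obtain c :: "nat list set \<Rightarrow> complex" and M0 where c: "M0 \<in> matchings d m" "c M0 \<noteq> 0"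
    "\<And>S. prk_le_on d (\<lambda>_. {..<m}) S r \<Longrightarrow> mform d m c S = 0"
    using complex_poly_imp_mform[OF assms(1) f f0] by blast
  obtain c' :: "nat list set \<Rightarrow> 'a" where "\<exists>M\<in>matchings d m. c' M \<noteq> 0"
    and c': "\<And>S. prk_le_on d (\<lambda>_. {..<m}) S r \<Longrightarrow> mform d m c' S = 0"
    by (rule mform_transfer[OF c]) blast+
  then obtain M where M: "M \<in> matchings d m" "c' M \<noteq> 0"
    by blast
  show "prk_on d (\<lambda>j. {..<n j}) T \<le> d * (m - 1) + (\<Sum>s=1..d div 2. (d choose s) * (m - 1) ^ (d - s))"
  proof (rule prk_on_le, rule prk_le_of_mform_vanishing[where c = c', OF assms(1) M], rule c',
      rule prk_le_on_pull[OF assms(1)])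
    fix \<phi> :: "nat \<Rightarrow> nat \<Rightarrow> nat"
    assume \<phi>: "\<And>j. j < d \<Longrightarrow> inj_on (\<phi> j) {..<m} \<and> \<phi> j ` {..<m} \<subseteq> {..<n j}"
    \<comment> \<open>By injectivity the images have exactly \<open>m\<close> elements, so the
      hypothesis on subtensors applies.\<close>
    then have "prk_on d (\<lambda>j. \<phi> j ` {..<m}) T \<le> r"
      using assms(6) by (simp add: card_image)
    then show "prk_le_on d (\<lambda>j. \<phi> j ` {..<m}) T r"
      by (intro prk_le_on_mono[OF assms(1) prk_le_on_prk_on[OF assms(1)]]) auto
  qed
qed (use assms(3) bound_le_power in simp)

end
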